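(* Let $p=2n+1$ be a prime with $p\equiv 1\pmod 4$, and write $p=c_p^2+4b_p^2$ with $c_p,b_p$ positive integers. Let $\chi_p$ be a generator of the group $\widehat{\mathbb{F}_p^{\times}}$ of multiplicative characters of $\mathbb{F}_p$, let $$y_p:=\boldsymbol{i}^{\frac{n-2}{2}}\cdot\sqrt{p-1}\cdot\prod_{0<k<n/2}\left(J_p(\phi,\chi_p^k)-J_p(\phi,\chi_p^{-k})\right),$$ and set $$z_p:=\frac{y_p}{2^{n-1}}.$$ Then $z_p\in\mathbb{Z}$ with $$\left(\frac{z_p}{p}\right)=1,$$ and for every nonsquare $d\in\mathbb{F}_p^{\times}$, $$\frac{|\det T_p(d)|}{2^{(p-1)/2}\,b_p}=z_p^2,$$ where $T_p(d)=\left[\phi(s_i+ds_j)\right]_{0\le i,j\le n}$.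
   Context: $\left(\frac{\cdot}{p}\right)$ is the Legendre symbol. $\widehat{\mathbb{F}_p^{\times}}$ is the cyclic group (of order $p-1$) of complex-valued multiplicative characters of $\mathbb{F}_p^\times$; every character $\chi_p^k$ (including the trivial one) is extended to $\mathbb{F}_p$ by $\chi_p^k(0)=0$. $\phi=\chi_p^{n}$ is the quadratic character: $\phi(x)=1$ if $x$ is a nonzero square, $\phi(0)=0$, $\phi(x)=-1$ if $x$ is a nonsquare. The Jacobi sum is $J_p(\chi_p^i,\chi_p^j)=\sum_{x\in\mathbb{F}_p}\chi_p^i(x)\chi_p^j(1-x)$. The set of squares of $\mathbb{F}_p$ is enumerated as $\{x^2:x\in\mathbb{F}_p\}=\{s_0=0,s_1=1,s_2,\dots,s_n\}$ with the $s_i$ distinct. The product defining $y_p$ runs over integers $k$ with $0<k<n/2$ (an empty product is $1$). $\boldsymbol{i}$ is the imaginary unit (primitive 4th root of unity with argument $\pi/2$). *)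

theory Defs
  imports Complex_Main "HOL-Number_Theory.Number_Theory" "Jordan_Normal_Form.Determinant"
begin

abbreviation Fp :: "nat \<Rightarrow> int ring" where
  "Fp p \<equiv> residue_ring (int p)"

definition Cx :: "complex monoid" where
  "Cx = \<lparr>carrier = - {0}, monoid.mult = (*), one = 1\<rparr>"

text \<open>
  The group of multiplicative characters of the field with \<open>p\<close> elements. Every character is
  stored as its extension by zero: all characters, the trivial one included, vanish at zero, and
  also on the integers that do not represent a field element. The latter makes a character
  determined by its values on the multiplicative group, so that equality of characters is equality
  of functions.
\<close>

definition char_group :: "nat \<Rightarrow> (int \<Rightarrow> complex) monoid" where
  "char_group p =
     \<lparr>carrier = {\<chi>. \<chi> \<in> hom (mult_of (Fp p)) Cx \<and> (\<forall>x. x \<notin> carrier (mult_of (Fp p)) \<longrightarrow> \<chi> x = 0)},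
      monoid.mult = (\<lambda>\<chi> \<psi> x. \<chi> x * \<psi> x),
      one = (\<lambda>x. if x \<in> carrier (mult_of (Fp p)) then 1 else 0)\<rparr>"

definition char_generator :: "nat \<Rightarrow> (int \<Rightarrow> complex) \<Rightarrow> bool" where
  "char_generator p \<chi> \<longleftrightarrow>
     \<chi> \<in> carrier (char_group p) \<and> generate (char_group p) {\<chi>} = carrier (char_group p)"

definition jacobi_sum :: "nat \<Rightarrow> (int \<Rightarrow> complex) \<Rightarrow> (int \<Rightarrow> complex) \<Rightarrow> complex" where
  "jacobi_sum p \<chi> \<psi> = (\<Sum>x\<in>carrier (Fp p). \<chi> x * \<psi> (\<one>\<^bsub>Fp p\<^esub> \<ominus>\<^bsub>Fp p\<^esub> x))"

definition quad_char :: "nat \<Rightarrow> int \<Rightarrow> int" where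
  "quad_char p x = Legendre x (int p)"

definition squares :: "nat \<Rightarrow> int set" where
  "squares p = (\<lambda>x. x \<otimes>\<^bsub>Fp p\<^esub> x) ` carrier (Fp p)"

text \<open>
  Below \<open>p = 2 * n + 1\<close> with \<open>n\<close> even and positive, so \<open>(n - 2) div 2\<close> involves neither truncated
  subtraction nor rounding.
\<close>

definition y_val :: "nat \<Rightarrow> nat \<Rightarrow> (int \<Rightarrow> complex) \<Rightarrow> complex" where
  "y_val p n \<chi> =
     \<i> ^ ((n - 2) div 2) * complex_of_real (sqrt (real p - 1)) *
     (\<Prod>k\<in>{k::int. 0 < k \<and> 2 * k < int n}.
        jacobi_sum p (\<lambda>x. of_int (quad_char p x)) (\<chi> [^]\<^bsub>char_group p\<^esub> k) -
        jacobi_sum p (\<lambda>x. of_int (quad_char p x)) (\<chi> [^]\<^bsub>char_group p\<^esub> (- k)))"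

definition z_val :: "nat \<Rightarrow> nat \<Rightarrow> (int \<Rightarrow> complex) \<Rightarrow> complex" where
  "z_val p n \<chi> = y_val p n \<chi> / 2 ^ (n - 1)"

definition T_mat :: "nat \<Rightarrow> nat \<Rightarrow> (nat \<Rightarrow> int) \<Rightarrow> int \<Rightarrow> int mat" where
  "T_mat p n s d =
     mat (n + 1) (n + 1) (\<lambda>(i, j). quad_char p (s i \<oplus>\<^bsub>Fp p\<^esub> d \<otimes>\<^bsub>Fp p\<^esub> s j))"

end

theory Submission
  imports Defs "HOL-Computational_Algebra.Field_as_Ring"
begin

text \<open>
  Write \<open>p = 4 * N + 1\<close>, let \<open>g\<close> be a primitive root and \<open>\<xi> = \<chi> g\<close>. With \<open>f a = \<phi> (1 - g ^ a)\<close>, the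
  symmetry \<open>f (- a) = (- 1) ^ a * f a\<close> gives \<open>J (\<phi>, \<chi> ^ k) - J (\<phi>, \<chi> ^ (- k)) = 2 * S k\<close>, where \<open>S k\<close> is
  the sum of \<open>f a * (\<xi> ^ (a * k) - \<xi> ^ (- a * k))\<close> over the odd \<open>a\<close> with \<open>0 < a < 2 * N\<close>. As the values of
  \<open>f\<close> are odd there, \<open>S k = 2 * (\<xi> ^ k - \<xi> ^ (- k)) * Q k\<close>, where \<open>Q k\<close>, for \<open>0 < k < N\<close>, runs through the
  eigenvalues of an integer matrix: a combination of Chebyshev polynomials in the adjacency matrix
  of a path with \<open>N - 1\<close> vertices. If \<open>D\<close> is its determinant, then \<open>z = N * D\<close> up to sign.

  The same factorisation holds modulo \<open>p\<close> with \<open>g\<close> in place of \<open>\<xi>\<close>, where \<open>2 * S k\<close> becomes the binomial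
  coefficient \<open>2 * N choose k\<close> up to sign. Wilson's theorem then shows that \<open>D\<close> is a square modulo \<open>p\<close>.

  Bordered by its first row and column, \<open>T d\<close> is a group matrix of the squares. Its determinant is, up to
  sign, \<open>2 * N\<close> times the product of the \<open>\<bar>S k\<bar>\<close> with \<open>0 < k < 2 * N\<close>. Since \<open>S (2 * N - k) = S k\<close>, this is a
  square times \<open>\<bar>S N\<bar>\<close>, and \<open>\<bar>S N\<bar> = 2 * b\<close> because the quartic Jacobi sum has norm \<open>p\<close>.
\<close>

subsection \<open>Determinants\<close>

text \<open>By the Leibniz expansion a determinant is a polynomial in its entries, so it can be
  compared modulo \<open>m\<close> without passing to a quotient ring.\<close>

lemma cong_det:
  fixes m :: "'a :: {comm_ring_1, unique_euclidean_ring}"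
  assumes "\<And>i j. i < n \<Longrightarrow> j < n \<Longrightarrow> [f i j = g i j] (mod m)"
  shows "[det (mat n n (\<lambda>(i, j). f i j)) = det (mat n n (\<lambda>(i, j). g i j))] (mod m)"
proof -
  have perm: "s i < n" if "s permutes {0..<n}" "i < n" for s i
    using permutes_in_image[OF that(1), of i] that(2) by simp
  have expand: "det (mat n n (\<lambda>(i, j). h i j)) =
      (\<Sum>s | s permutes {0..<n}. signof s * (\<Prod>i = 0..<n. h i (s i)))" for h :: "nat \<Rightarrow> nat \<Rightarrow> 'a"
    by (subst det_def'[of _ n]) (auto intro!: sum.cong prod.cong simp: perm)
  show ?thesis
    unfolding expand
    by (intro cong_sum cong_scalar_left cong_prod) (use assms perm in auto)
qed

lemma det_mat_lower_triangular:
  assumes "\<And>i j. i < j \<Longrightarrow> j < n \<Longrightarrow> f i j = (0 :: 'a :: idom)"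
  shows "det (mat n n (\<lambda>(i, j). f i j)) = (\<Prod>i<n. f i i)"
proof -
  have "det (mat n n (\<lambda>(i, j). f i j)) = prod_list (diag_mat (mat n n (\<lambda>(i, j). f i j)))"
    by (rule det_lower_triangular[of n]) (use assms in auto)
  also have "\<dots> = (\<Prod>i<n. f i i)"
    by (simp add: prod_list_diag_prod atLeast0LessThan)
  finally show ?thesis .
qed

lemma det_mat_upper_triangular:
  assumes "\<And>i j. j < i \<Longrightarrow> i < n \<Longrightarrow> f i j = (0 :: 'a :: idom)"
  shows "det (mat n n (\<lambda>(i, j). f i j)) = (\<Prod>i<n. f i i)"
proof -
  have "mat n n (\<lambda>(i, j). f i j) = transpose_mat (mat n n (\<lambda>(i, j). f j i))"
    by (intro eq_matI) auto
  also have "det \<dots> = det (mat n n (\<lambda>(i, j). f j i))"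
    by (rule det_transpose[of _ n]) auto
  also have "\<dots> = (\<Prod>i<n. f i i)"
    by (rule det_mat_lower_triangular) (use assms in auto)
  finally show ?thesis .
qed

lemma det_mat_mult:
  "det (mat n n (\<lambda>(i, j). \<Sum>l<n. f i l * g l j)) =
     det (mat n n (\<lambda>(i, j). f i j)) * det (mat n n (\<lambda>(i, j). g i j :: 'a :: comm_ring_1))"
proof -
  have "mat n n (\<lambda>(i, j). \<Sum>l<n. f i l * g l j) =
      mat n n (\<lambda>(i, j). f i j) * mat n n (\<lambda>(i, j). g i j)"
    by (intro eq_matI) (auto simp: scalar_prod_def atLeast0LessThan)
  then show ?thesis
    by (simp add: det_mult[of _ n])
qed

lemma det_mat_scale_columns:
  "det (mat n n (\<lambda>(i, j). f i j * c j)) = det (mat n n (\<lambda>(i, j). f i j)) * (\<Prod>j<n. c j :: 'a :: idom)"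
proof -
  have "det (mat n n (\<lambda>(i, j). f i j * c j)) =
      det (mat n n (\<lambda>(i, j). \<Sum>l<n. f i l * (if l = j then c j else 0)))"
    by (intro arg_cong[where f = det] eq_matI) (auto simp: if_distrib sum.delta cong: if_cong)
  also have "\<dots> = det (mat n n (\<lambda>(i, j). f i j)) * (\<Prod>j<n. c j)"
    by (simp only: det_mat_mult) (simp add: det_mat_lower_triangular)
  finally show ?thesis .
qed

text \<open>\<open>cheb M i j l\<close> is the \<open>(j, l)\<close> entry of \<open>U i (A / 2)\<close>, where \<open>U i\<close> is the Chebyshev polynomial of the
  second kind and \<open>A\<close> the adjacency matrix of the path with vertices \<open>0, \<dots>, M - 1\<close>.\<close>
fun cheb :: "nat \<Rightarrow> nat \<Rightarrow> nat \<Rightarrow> nat \<Rightarrow> int" where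
  "cheb M 0 j l = (if j = l then 1 else 0)"
| "cheb M (Suc 0) j l = (if j = Suc l \<or> l = Suc j then 1 else 0)"
| "cheb M (Suc (Suc i)) j l =
     (if j = 0 then 0 else cheb M (Suc i) (j - 1) l) +
     (if Suc j < M then cheb M (Suc i) (Suc j) l else 0) - cheb M i j l"

text \<open>This is U_i(x / 2): at x = 2 cos t its value is sin ((i + 1) t) / sin t.\<close>

fun cheb_poly :: "'a :: comm_ring_1 \<Rightarrow> nat \<Rightarrow> 'a" where
  "cheb_poly x 0 = 1"
| "cheb_poly x (Suc 0) = x"
| "cheb_poly x (Suc (Suc i)) = x * cheb_poly x (Suc i) - cheb_poly x i"

text \<open>The product of \<open>A - 2\<close> with the upper triangular matrix \<open>?Y\<close> is lower triangular.\<close>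
lemma det_path_minus_two:
  "det (mat M M (\<lambda>(j, l). cheb M (Suc 0) j l - 2 * cheb M 0 j l)) = (-1) ^ M * (int M + 1)"
proof -
  let ?A = "\<lambda>j l. cheb M (Suc 0) j l - 2 * cheb M 0 j l"
  \<comment> \<open>The sequence \<open>l + 1\<close> has second difference zero and vanishes at l =
    -1. Column \<open>k\<close> cuts it off after position \<open>k\<close>, so its image under A -
    2 lives only in rows \<open>k\<close> and \<open>k + 1\<close>.\<close>
  let ?Y = "\<lambda>l k. if l \<le> k then int l + 1 else 0 :: int"
  have prod: "(\<Sum>l<M. ?A j l * ?Y l k) =
      (if j = k then - (int k + 2) else if j = Suc k then int k + 1 else 0)"
    if "j < M" "k < M" for j k
  proof -
    have "(\<Sum>l<M. ?A j l * ?Y l k) =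
        (\<Sum>l<M. (if l = Suc j then ?Y (Suc j) k else 0) +
          (if l = j - 1 then (if j = 0 then 0 else ?Y (j - 1) k) else 0) + (if l = j then -2 * ?Y j k else 0))"
      by (rule sum.cong) auto
    also have "\<dots> = (if Suc j < M then ?Y (Suc j) k else 0) + (if j = 0 then 0 else ?Y (j - 1) k) - 2 * ?Y j k"
      using that by (simp add: sum.distrib sum.delta)
    also have "\<dots> = (if j = k then - (int k + 2) else if j = Suc k then int k + 1 else 0)"
      using that by (auto simp: of_nat_diff)
    finally show ?thesis .
  qed
  have "det (mat M M (\<lambda>(j, l). ?A j l)) * (\<Prod>i<M. ?Y i i) =
      det (mat M M (\<lambda>(j, k). \<Sum>l<M. ?A j l * ?Y l k))"
    by (simp only: det_mat_mult, subst (2) det_mat_upper_triangular) auto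
  also have "\<dots> = det (mat M M (\<lambda>(j, k). if j = k then - (int k + 2) else if j = Suc k then int k + 1 else 0))"
    by (intro arg_cong[where f = det] eq_matI) (use prod in auto)
  also have "\<dots> = (\<Prod>k<M. - (int k + 2))"
    by (subst det_mat_lower_triangular) auto
  also have "\<dots> = (-1) ^ M * (int M + 1) * (\<Prod>i<M. ?Y i i)"
    by (induction M) (auto simp: algebra_simps)
  finally show ?thesis
    by (subst (asm) mult_cancel_right) (auto simp: prod_zero_iff)
qed

subsection \<open>Sine transforms over roots of unity\<close>

text \<open>A root of unity of order \<open>4 * N\<close>, with inverse \<open>\<eta>\<close>, modulo \<open>m\<close>. The congruences are equalities for
  \<open>m = 0\<close>; this covers both a complex root of unity and a primitive root modulo a prime.\<close>
locale root_mod =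
  fixes m \<xi> \<eta> :: "'a :: {idom, unique_euclidean_ring}" and N :: nat
  assumes prime_like: "\<And>a b. m dvd a * b \<Longrightarrow> m dvd a \<or> m dvd b"
    and N_pos: "N > 0"
    and inverse: "[\<xi> * \<eta> = 1] (mod m)"
    and half_period: "[\<xi> ^ (2 * N) = -1] (mod m)"
    and primitive: "\<And>t. 0 < t \<Longrightarrow> t < 2 * N \<Longrightarrow> \<not> [\<xi> ^ (2 * t) = 1] (mod m)"
    and nonzero: "\<not> m dvd of_nat (2 * N)"
begin

text \<open>For complex \<xi> of modulus 1 and argument t these are 2i sin (kt) and, below, 2 cos
  (kt). Leaving out the denominators makes the trigonometric identities meaningful modulo
  \<open>m\<close>.\<close>

abbreviation sn :: "nat \<Rightarrow> 'a" where "sn k \<equiv> \<xi> ^ k - \<eta> ^ k"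
abbreviation cs :: "nat \<Rightarrow> 'a" where "cs k \<equiv> \<xi> ^ k + \<eta> ^ k"

lemma cancel:
  assumes "[a * c = b * c] (mod m)" "\<not> m dvd c"
  shows "[a = b] (mod m)"
  using assms prime_like[of "a - b" c] by (simp add: cong_iff_dvd_diff left_diff_distrib)

lemma not_dvd_prod: "finite A \<Longrightarrow> (\<And>x. x \<in> A \<Longrightarrow> \<not> m dvd f x) \<Longrightarrow> \<not> m dvd prod f A"
proof (induction A rule: finite_induct)
  case empty
  \<comment> \<open>A modulus dividing 1 would also divide \<open>2 * N\<close>.\<close>
  then show ?case using nonzero by (metis dvd_trans one_dvd prod.empty)
next
  case (insert x F)
  then show ?case using prime_like by (metis insertCI prod.insert)
qed

lemma inverse_pow: "[\<xi> ^ k * \<eta> ^ k = 1] (mod m)"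
  using cong_pow[OF inverse, of k] by (simp add: power_mult_distrib)

lemma pow_diff: "b \<le> a \<Longrightarrow> [\<xi> ^ a * \<eta> ^ b = \<xi> ^ (a - b)] (mod m)"
  using cong_scalar_left[OF inverse_pow[of b], of "\<xi> ^ (a - b)"]
  by (simp add: mult.assoc[symmetric] power_add[symmetric])

lemma pow_diff': "b \<le> a \<Longrightarrow> [\<eta> ^ a * \<xi> ^ b = \<eta> ^ (a - b)] (mod m)"
  using cong_scalar_left[OF inverse_pow[of b], of "\<eta> ^ (a - b)"]
  by (simp add: mult.left_commute[of _ "\<xi> ^ b"] power_add[symmetric] ac_simps)

lemma cs_mult_sn:
  assumes "b \<le> a"
  shows "[cs b * sn a = sn (a + b) + sn (a - b)] (mod m)"
proof -
  have "cs b * sn a = sn (a + b) + (\<xi> ^ a * \<eta> ^ b - \<eta> ^ a * \<xi> ^ b)"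
    by (simp add: algebra_simps power_add)
  also have "[\<dots> = sn (a + b) + sn (a - b)] (mod m)"
    by (intro cong_add cong_diff pow_diff pow_diff' assms cong_refl)
  finally show ?thesis .
qed

lemma sn_mult_sn:
  assumes "b \<le> a"
  shows "[sn a * sn b = cs (a + b) - cs (a - b)] (mod m)"
proof -
  have "sn a * sn b = cs (a + b) - (\<xi> ^ a * \<eta> ^ b + \<eta> ^ a * \<xi> ^ b)"
    by (simp add: algebra_simps power_add)
  also have "[\<dots> = cs (a + b) - cs (a - b)] (mod m)"
    by (intro cong_add cong_diff pow_diff pow_diff' assms cong_refl)
  finally show ?thesis .
qed

lemma half_period': "[\<eta> ^ (2 * N) = -1] (mod m)"
proof -
  have "[- (\<eta> ^ (2 * N)) = \<xi> ^ (2 * N) * \<eta> ^ (2 * N)] (mod m)"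
    using cong_scalar_right[OF half_period, of "\<eta> ^ (2 * N)"] by (simp add: cong_sym)
  also note inverse_pow
  finally show ?thesis
    using cong_minus_minus_iff[of "\<eta> ^ (2 * N)" "-1" m] by simp
qed

lemma sn_half_period: "[sn (2 * N * k) = 0] (mod m)"
proof -
  have "[sn (2 * N * k) = (-1) ^ k - (-1) ^ k] (mod m)"
    by (subst (1 2) power_mult[of _ "2 * N" k]) (intro cong_diff cong_pow half_period half_period')
  then show ?thesis by simp
qed

lemma power_half_period: "[\<xi> ^ (2 * N * k) = (-1) ^ k] (mod m)"
  by (subst power_mult[of _ "2 * N" k]) (intro cong_pow half_period)

lemma full_period: "[\<xi> ^ (4 * N * t) = 1] (mod m)" "[\<eta> ^ (4 * N * t) = 1] (mod m)"
proof -
  have "[\<xi> ^ (2 * N * (2 * t)) = (-1) ^ (2 * t)] (mod m)" "[\<eta> ^ (2 * N * (2 * t)) = (-1) ^ (2 * t)] (mod m)"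
    by (subst power_mult[of _ "2 * N" "2 * t"], intro cong_pow half_period half_period')+
  moreover have "2 * N * (2 * t) = 4 * N * t" by simp
  ultimately show "[\<xi> ^ (4 * N * t) = 1] (mod m)" "[\<eta> ^ (4 * N * t) = 1] (mod m)"
    by (simp_all only: power_mult[of _ 2 t]) simp_all
qed

lemma full_period_diff:
  assumes "c \<le> 4 * N"
  shows "[\<xi> ^ ((4 * N - c) * t) = \<eta> ^ (c * t)] (mod m)" "[\<eta> ^ ((4 * N - c) * t) = \<xi> ^ (c * t)] (mod m)"
proof -
  have eq: "4 * N * t - c * t = (4 * N - c) * t"
    by (simp only: diff_mult_distrib)
  have le: "c * t \<le> 4 * N * t"
    by (rule mult_le_mono1[OF assms])
  have "[\<xi> ^ (4 * N * t) * \<eta> ^ (c * t) = 1 * \<eta> ^ (c * t)] (mod m)"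
    "[\<eta> ^ (4 * N * t) * \<xi> ^ (c * t) = 1 * \<xi> ^ (c * t)] (mod m)"
    by (intro cong_scalar_right full_period)+
  with pow_diff[OF le] pow_diff'[OF le]
  show "[\<xi> ^ ((4 * N - c) * t) = \<eta> ^ (c * t)] (mod m)" "[\<eta> ^ ((4 * N - c) * t) = \<xi> ^ (c * t)] (mod m)"
    unfolding eq by (auto intro: cong_trans cong_sym)
qed

text \<open>A geometric series: the ratio minus 1 is not divisible by \<open>m\<close> by
  \<open>primitive\<close>, so \<open>prime_like\<close> cancels it.\<close>

lemma sum_powers:
  assumes "0 < t" "t < 2 * N"
  shows "[(\<Sum>c<2*N. \<xi> ^ (2 * c * t)) = 0] (mod m)"
proof -
  have "(\<xi> ^ (2 * t) - 1) * (\<Sum>c<2*N. (\<xi> ^ (2 * t)) ^ c) = (\<xi> ^ (2 * t)) ^ (2 * N) - 1"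
    by (simp add: power_diff_1_eq)
  also have "(\<xi> ^ (2 * t)) ^ (2 * N) = \<xi> ^ (2 * N * (2 * t))"
    by (simp add: power_mult[symmetric] mult_ac)
  also have "[\<dots> - 1 = (-1) ^ (2 * t) - 1] (mod m)"
    by (intro cong_diff power_half_period cong_refl)
  finally have "m dvd (\<xi> ^ (2 * t) - 1) * (\<Sum>c<2*N. (\<xi> ^ (2 * t)) ^ c)"
    by (simp add: cong_0_iff)
  moreover have "\<not> m dvd \<xi> ^ (2 * t) - 1"
    using primitive[OF assms] by (simp add: cong_iff_dvd_diff)
  ultimately have "m dvd (\<Sum>c<2*N. (\<xi> ^ (2 * t)) ^ c)"
    using prime_like by blast
  then show ?thesis
    by (simp add: cong_0_iff power_mult[symmetric] mult_ac)
qed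

text \<open>Folding the sum of \<open>sum_powers\<close> by c -> 2N - c turns \<xi> into \<eta>. The
  unpaired terms c = 0 and c = N contribute 1 and (-1)^t.\<close>

lemma sum_cs:
  assumes "0 < t" "t < 2 * N"
  shows "[(\<Sum>c = 1..<N. cs (2 * c * t)) = - 1 - (-1) ^ t] (mod m)"
proof -
  let ?f = "\<lambda>c. \<xi> ^ (2 * c * t)"
  have "{..<2*N} = {0} \<union> {1..<N} \<union> {N} \<union> {N + 1..<2*N}"
    using N_pos by auto
  then have "(\<Sum>c<2*N. ?f c) = 1 + (\<Sum>c = 1..<N. ?f c) + ?f N + (\<Sum>c = N + 1..<2*N. ?f c)"
    using N_pos by (simp add: sum.union_disjoint)
  also have "(\<Sum>c = N + 1..<2*N. ?f c) = (\<Sum>c = 1..<N. ?f (2 * N - c))"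
    by (rule sum.reindex_bij_witness[where i = "\<lambda>c. 2 * N - c" and j = "\<lambda>c. 2 * N - c"]) auto
  also have "[1 + (\<Sum>c = 1..<N. ?f c) + ?f N + \<dots> =
      1 + (\<Sum>c = 1..<N. ?f c) + (-1) ^ t + (\<Sum>c = 1..<N. \<eta> ^ (2 * c * t))] (mod m)"
    (is "[_ = ?r] (mod m)")
    using power_half_period[of t]
    using full_period_diff(1)[of "2 * c" t for c]
    by (intro cong_add cong_refl cong_sum) (auto simp: diff_mult_distrib2)
  also have "?r = (\<Sum>c = 1..<N. cs (2 * c * t)) - (- 1 - (-1) ^ t)"
    by (simp add: sum.distrib)
  finally have "[(\<Sum>c = 1..<N. cs (2 * c * t)) - (- 1 - (-1) ^ t) = (\<Sum>c<2*N. ?f c)] (mod m)"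
    by (rule cong_sym)
  also note sum_powers[OF assms]
  finally show ?thesis
    by (simp only: cong_diff_iff_cong_0)
qed

text \<open>The product formula leaves two cosine sums, with a + b and a - b. These have equal
  parity, so for distinct a and b the values from \<open>sum_cs\<close> cancel; for a = b the second
  sum is constant.\<close>

lemma sine_orthogonality_aux:
  assumes "0 < b" "b \<le> a" "a < N"
  shows "[(\<Sum>c = 1..<N. sn (2 * c * a) * sn (2 * c * b)) = (if a = b then - of_nat (2 * N) else 0)] (mod m)"
proof -
  have "[(\<Sum>c = 1..<N. sn (2 * c * a) * sn (2 * c * b)) =
      (\<Sum>c = 1..<N. cs (2 * c * a + 2 * c * b) - cs (2 * c * a - 2 * c * b))] (mod m)"
    (is "[_ = ?r] (mod m)")
    using assms by (intro cong_sum sn_mult_sn) auto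
  also have "?r = (\<Sum>c = 1..<N. cs (2 * c * (a + b))) - (\<Sum>c = 1..<N. cs (2 * c * (a - b)))"
    by (simp only: sum_subtractf add_mult_distrib2 diff_mult_distrib2)
  also have "[\<dots> = (- 1 - (-1) ^ (a + b)) - (if a = b then 2 * of_nat (N - 1) else - 1 - (-1) ^ (a - b))] (mod m)"
  proof (intro cong_diff)
    show "[(\<Sum>c = 1..<N. cs (2 * c * (a + b))) = - 1 - (-1) ^ (a + b)] (mod m)"
      using assms by (intro sum_cs) auto
    show "[(\<Sum>c = 1..<N. cs (2 * c * (a - b))) =
        (if a = b then 2 * of_nat (N - 1) else - 1 - (-1) ^ (a - b))] (mod m)"
      using assms sum_cs[of "a - b"] by (cases "a = b") (simp_all add: mult.commute)
  qed
  also have "(- 1 - (-1) ^ (a + b)) - (if a = b then 2 * of_nat (N - 1) else - 1 - (-1) ^ (a - b)) =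
      (if a = b then - of_nat (2 * N) else (0 :: 'a))"
  proof (cases "a = b")
    case True
    then show ?thesis using N_pos by (simp add: of_nat_diff mult_2[symmetric] algebra_simps)
  next
    case False
    have "a + b = (a - b) + 2 * b" using assms by simp
    then have "(-1 :: 'a) ^ (a + b) = (-1) ^ (a - b)"
      by (simp only: power_add power_mult) simp
    then show ?thesis using False by simp
  qed
  finally show ?thesis .
qed

lemma sine_orthogonality:
  assumes "0 < a" "a < N" "0 < b" "b < N"
  shows "[(\<Sum>c = 1..<N. sn (2 * c * a) * sn (2 * c * b)) = (if a = b then - of_nat (2 * N) else 0)] (mod m)"
proof (cases "b \<le> a")
  case True
  then show ?thesis using assms by (intro sine_orthogonality_aux)
next
  case False
  then show ?thesis using sine_orthogonality_aux[of a b] assms by (auto simp: mult.commute)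
qed

section \<open>Diagonalising the path by the discrete sine transform\<close>

abbreviation sine :: "nat \<Rightarrow> nat \<Rightarrow> 'a" where
  "sine l k \<equiv> sn (2 * Suc l * Suc k)"

text \<open>The sine matrix is symmetric, so orthogonality says that its square is -2N times the
  identity.\<close>

lemma det_sine_squared:
  "[det (mat (N - 1) (N - 1) (\<lambda>(l, k). sine l k)) ^ 2 = (- of_nat (2 * N)) ^ (N - 1)] (mod m)"
proof -
  have "[det (mat (N - 1) (N - 1) (\<lambda>(i, j). \<Sum>l<N - 1. sine i l * sine l j)) =
      det (mat (N - 1) (N - 1) (\<lambda>(i, j). if i = j then - of_nat (2 * N) else 0))] (mod m)"
  proof (rule cong_det)
    fix i j assume *: "i < N - 1" "j < N - 1"
    have "(\<Sum>l<N - 1. sine i l * sine l j) = (\<Sum>c = 1..<N. sn (2 * c * Suc i) * sn (2 * c * Suc j))"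
      by (rule sum.reindex_bij_witness[where i = "\<lambda>c. c - 1" and j = Suc])
        (auto simp: mult_ac simp del: mult_Suc mult_Suc_right)
    then show "[(\<Sum>l<N - 1. sine i l * sine l j) = (if i = j then - of_nat (2 * N) else 0)] (mod m)"
      using sine_orthogonality[of "Suc i" "Suc j"] * by simp
  qed
  moreover have "det (mat (N - 1) (N - 1) (\<lambda>(i, j). if i = j then - of_nat (2 * N) else 0 :: 'a)) =
      (- of_nat (2 * N)) ^ (N - 1)"
    by (rule trans[OF det_mat_lower_triangular]) (simp_all only: split: if_splits, simp_all)
  ultimately show ?thesis
    by (simp only: det_mat_mult power2_eq_square)
qed

lemma det_sine_not_dvd: "\<not> m dvd det (mat (N - 1) (N - 1) (\<lambda>(l, k). sine l k))"
proof
  assume "m dvd det (mat (N - 1) (N - 1) (\<lambda>(l, k). sine l k))"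
  then have "m dvd det (mat (N - 1) (N - 1) (\<lambda>(l, k). sine l k)) ^ 2"
    unfolding power2_eq_square by (rule dvd_mult2)
  then have "m dvd (- of_nat (2 * N)) ^ (N - 1)"
    using cong_dvd_iff[OF det_sine_squared] by simp
  moreover have "\<not> m dvd (\<Prod>i<N - 1. - of_nat (2 * N))"
    using nonzero by (intro not_dvd_prod) (simp_all only: finite_lessThan dvd_minus_iff not_False_eq_True)
  ultimately show False by (simp only: prod_constant card_lessThan not_True_eq_False)
qed

text \<open>With X the sine matrix, the hypothesis reads E X = X diag(e); taking determinants and
  cancelling det X gives the claim. As \<open>E\<close> has integer entries, one and the same
  integer determinant can be evaluated both over the complex numbers and modulo a prime.\<close>

lemma det_eq_prod_eigenvalues:
  assumes "\<And>j k. j < N - 1 \<Longrightarrow> k < N - 1 \<Longrightarrow>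
    [(\<Sum>l<N - 1. of_int (E j l) * sine l k) = e k * sine j k] (mod m)"
  shows "[of_int (det (mat (N - 1) (N - 1) (\<lambda>(j, l). E j l))) = (\<Prod>k<N - 1. e k)] (mod m)"
proof -
  let ?M = "N - 1"
  let ?D = "det (mat ?M ?M (\<lambda>(l, k). sine l k))"
  have "of_int (det (mat ?M ?M (\<lambda>(j, l). E j l))) = det (mat ?M ?M (\<lambda>(j, l). of_int (E j l) :: 'a))"
    by (subst of_int_hom.hom_det[symmetric]) (auto intro!: arg_cong[where f = det] eq_matI simp del: of_int_hom.hom_det)
  then have "of_int (det (mat ?M ?M (\<lambda>(j, l). E j l))) * ?D =
      det (mat ?M ?M (\<lambda>(j, k). \<Sum>l<?M. of_int (E j l) * sine l k))"
    by (simp only: det_mat_mult)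
  moreover have "(\<Prod>k<?M. e k) * ?D = det (mat ?M ?M (\<lambda>(j, k). sine j k * e k))"
    by (rule trans[OF mult.commute det_mat_scale_columns[symmetric]])
  moreover have "[det (mat ?M ?M (\<lambda>(j, k). \<Sum>l<?M. of_int (E j l) * sine l k)) =
      det (mat ?M ?M (\<lambda>(j, k). sine j k * e k))] (mod m)"
    by (rule cong_det, subst mult.commute[of "sine _ _"], rule assms)
  ultimately have "[of_int (det (mat ?M ?M (\<lambda>(j, l). E j l))) * ?D = (\<Prod>k<?M. e k) * ?D] (mod m)"
    by (simp only:)
  then show ?thesis
    by (rule cancel[OF _ det_sine_not_dvd])
qed

lemma cs_mult_sine:
  "[cs (2 * Suc k) * sine j k = sine (Suc j) k + (if j = 0 then 0 else sine (j - 1) k)] (mod m)"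
proof -
  have "[cs (2 * Suc k) * sine j k =
      sn (2 * Suc j * Suc k + 2 * Suc k) + sn (2 * Suc j * Suc k - 2 * Suc k)] (mod m)"
    by (rule cs_mult_sn) simp
  also have "2 * Suc j * Suc k + 2 * Suc k = 2 * Suc (Suc j) * Suc k" by simp
  also have "2 * Suc j * Suc k - 2 * Suc k = 2 * j * Suc k" by simp
  finally show ?thesis by (cases j) simp_all
qed

text \<open>The sine vectors vanish just beyond the last vertex; this boundary condition makes them
  eigenvectors of a path.\<close>

lemma sine_boundary: "[sine (N - 1) k = 0] (mod m)"
  using sn_half_period[of "Suc k"] N_pos by simp

text \<open>The missing neighbours at both ends may be added freely, since the sine vector vanishes
  there. The factor \<open>c\<close> carries the Chebyshev value reached so far in the induction of
  \<open>cheb_eigen\<close>.\<close>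

lemma path_eigen:
  assumes "j < N - 1"
  shows "[(if j = 0 then 0 else c * sine (j - 1) k) + (if Suc j < N - 1 then c * sine (Suc j) k else 0) =
    cs (2 * Suc k) * c * sine j k] (mod m)"
proof -
  have "[(if Suc j < N - 1 then c * sine (Suc j) k else 0) = c * sine (Suc j) k] (mod m)"
  proof (cases "Suc j < N - 1")
    case False
    then have "Suc j = N - 1" using assms by simp
    then show ?thesis
      using False sine_boundary[of k] by (auto simp: cong_sym_eq[of 0] cong_0_iff simp del: power_Suc)
  qed simp
  then have "[(if j = 0 then 0 else c * sine (j - 1) k) + (if Suc j < N - 1 then c * sine (Suc j) k else 0) =
      (if j = 0 then 0 else c * sine (j - 1) k) + c * sine (Suc j) k] (mod m)"
    (is "[_ = ?r] (mod m)")
    by (intro cong_add cong_refl)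
  also have "?r = c * (sine (Suc j) k + (if j = 0 then 0 else sine (j - 1) k))"
    by (auto simp: algebra_simps simp del: power_Suc)
  also have "[\<dots> = c * (cs (2 * Suc k) * sine j k)] (mod m)"
    by (intro cong_scalar_left cong_sym[OF cs_mult_sine])
  finally show ?thesis by (simp only: mult_ac)
qed

lemma cheb_eigen:
  assumes "j < N - 1"
  shows "[(\<Sum>l<N - 1. of_int (cheb (N - 1) i j l) * sine l k) =
    cheb_poly (cs (2 * Suc k)) i * sine j k] (mod m)"
  using assms
proof (induction i arbitrary: j rule: induct_nat_012)
  case 0
  have "(\<Sum>l<N - 1. of_int (cheb (N - 1) 0 j l) * sine l k) = (\<Sum>l<N - 1. if l = j then sine j k else 0)"
    by (intro sum.cong) (auto simp del: power_Suc)
  then show ?case using 0 by (simp add: sum.delta del: power_Suc)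
next
  case 1
  have "(\<Sum>l<N - 1. of_int (cheb (N - 1) 1 j l) * sine l k) =
      (\<Sum>l<N - 1. (if l = j - 1 then if j = 0 then 0 else sine (j - 1) k else 0) +
        (if l = Suc j then sine (Suc j) k else 0))"
    by (intro sum.cong) (auto simp del: power_Suc)
  also have "\<dots> = (if j = 0 then 0 else 1 * sine (j - 1) k) + (if Suc j < N - 1 then 1 * sine (Suc j) k else 0)"
    using 1 by (simp add: sum.distrib sum.delta less_imp_diff_less del: power_Suc)
  also have "[\<dots> = cs (2 * Suc k) * 1 * sine j k] (mod m)"
    using 1 by (rule path_eigen)
  finally show ?case by (simp del: power_Suc)
next
  case (ge2 i)
  let ?s = "\<lambda>i j. \<Sum>l<N - 1. of_int (cheb (N - 1) i j l) * sine l k"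
  let ?u = "cheb_poly (cs (2 * Suc k))"
  let ?a = "if j = 0 then 0 else ?s (Suc i) (j - 1)"
  let ?b = "if Suc j < N - 1 then ?s (Suc i) (Suc j) else 0"
  let ?a' = "if j = 0 then 0 else ?u (Suc i) * sine (j - 1) k"
  let ?b' = "if Suc j < N - 1 then ?u (Suc i) * sine (Suc j) k else 0"
  have 1: "?s (Suc (Suc i)) j = ?a + ?b - ?s i j"
    by (simp add: distrib_right left_diff_distrib sum.distrib sum_subtractf del: power_Suc)
  have a: "[?a = ?a'] (mod m)"
    using ge2.IH(2)[of "j - 1"] ge2.prems
    by (cases "j = 0") (simp_all only: if_True if_False simp_thms less_imp_diff_less cong_refl)
  have b: "[?b = ?b'] (mod m)"
    using ge2.IH(2)[of "Suc j"]
    by (cases "Suc j < N - 1") (simp_all only: if_True if_False simp_thms cong_refl)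
  have 2: "[?a + ?b - ?s i j = ?a' + ?b' - ?u i * sine j k] (mod m)"
    by (rule cong_diff[OF cong_add[OF a b] ge2.IH(1)[OF ge2.prems]])
  have 3: "[?a' + ?b' - ?u i * sine j k = cs (2 * Suc k) * ?u (Suc i) * sine j k - ?u i * sine j k] (mod m)"
    by (rule cong_diff[OF path_eigen[OF ge2.prems] cong_refl])
  show ?case
    unfolding 1 cheb_poly.simps left_diff_distrib by (rule cong_trans[OF 2 3])
qed

text \<open>The classical identity sin t * U_i(cos t) = sin ((i + 1) t), proved along the Chebyshev
  recurrence.\<close>

lemma cheb_poly_sn: "[sn (2 * k) * cheb_poly (cs (2 * k)) i = sn (2 * Suc i * k)] (mod m)"
proof (induction i rule: induct_nat_012)
  case 1
  have "[cs (2 * k) * sn (2 * k) = sn (2 * k + 2 * k) + sn (2 * k - 2 * k)] (mod m)"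
    by (rule cs_mult_sn) simp
  then show ?case by (simp add: mult.commute flip: mult_2)
next
  case (ge2 i)
  have "sn (2 * k) * cheb_poly (cs (2 * k)) (Suc (Suc i)) =
      cs (2 * k) * (sn (2 * k) * cheb_poly (cs (2 * k)) (Suc i)) - sn (2 * k) * cheb_poly (cs (2 * k)) i"
    by (simp add: algebra_simps)
  also have "[\<dots> = cs (2 * k) * sn (2 * Suc (Suc i) * k) - sn (2 * Suc i * k)] (mod m)"
    by (intro cong_diff cong_scalar_left ge2)
  also have "[cs (2 * k) * sn (2 * Suc (Suc i) * k) - sn (2 * Suc i * k) =
      (sn (2 * Suc (Suc i) * k + 2 * k) + sn (2 * Suc (Suc i) * k - 2 * k)) - sn (2 * Suc i * k)] (mod m)"
    by (intro cong_diff cs_mult_sn cong_refl) simp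
  also have "2 * Suc (Suc i) * k + 2 * k = 2 * Suc (Suc (Suc i)) * k" by simp
  also have "2 * Suc (Suc i) * k - 2 * k = 2 * Suc i * k" by simp
  finally show ?case by (simp only: add_diff_cancel_right')
qed simp

text \<open>Since \<open>cs k * sn k\<close> is \<open>sn (2 * k)\<close>, divisibility would give
  \<xi>^(4k) = 1, against \<open>primitive\<close>. This licenses the cancellation of
  \<open>cs K\<close> in the next factorisation.\<close>

lemma cs_not_dvd:
  assumes "0 < k" "k < N"
  shows "\<not> m dvd cs k"
proof
  assume "m dvd cs k"
  then have "m dvd cs k * sn k" by simp
  then have "[\<xi> ^ (2 * k) = \<eta> ^ (2 * k)] (mod m)"
    by (simp add: cong_iff_dvd_diff algebra_simps flip: power_add mult_2)
  then have "[\<xi> ^ (2 * k) * \<xi> ^ (2 * k) = \<xi> ^ (2 * k) * \<eta> ^ (2 * k)] (mod m)"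
    by (rule cong_scalar_left)
  also note inverse_pow
  finally have "[\<xi> ^ (2 * (2 * k)) = 1] (mod m)"
    by (simp only: mult_2 power_add)
  then show False
    using primitive[of "2 * k"] assms by simp
qed

section \<open>Factoring the sine sums through an integer matrix\<close>

definition sine_sum :: "(nat \<Rightarrow> int) \<Rightarrow> nat \<Rightarrow> 'a" where
  "sine_sum F k = (\<Sum>j<N. of_int (F j) * sn ((2 * j + 1) * k))"

text \<open>Multiplication by \<open>cs K\<close> replaces each sine at an odd multiple by two
  neighbouring sines at even multiples. Regrouping gives the coefficients
  \<open>F i + F (Suc i)\<close>, which are even because \<open>F\<close> is odd-valued. Each sine
  at an even multiple is \<open>sn (2 * K) = sn K * cs K\<close> times a Chebyshev value, and
  \<open>cs K\<close> cancels again.\<close>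

lemma sine_sum_eigenvalue:
  assumes "\<And>j. j < N \<Longrightarrow> odd (F j)" and "k < N - 1"
  shows "[sine_sum F (Suc k) = 2 * sn (Suc k) *
    (\<Sum>i<N - 1. of_int ((F i + F (Suc i)) div 2) * cheb_poly (cs (2 * Suc k)) i)] (mod m)"
proof -
  define K where "K = Suc k"
  let ?s = "\<lambda>j. sn (2 * j * K)"
  let ?G = "\<lambda>i. (F i + F (Suc i)) div 2"
  let ?q = "\<Sum>i<N - 1. of_int (?G i) * cheb_poly (cs (2 * K)) i"
  obtain M where M: "N = Suc M" using N_pos by (cases N) auto
  have G: "of_int (F i) + of_int (F (Suc i)) = (2 * of_int (?G i) :: 'a)" if "i < M" for i
  proof -
    have "F i + F (Suc i) = 2 * ?G i"
      using assms(1)[of i] assms(1)[of "Suc i"] that M by simp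
    then show ?thesis by (metis of_int_add of_int_mult of_int_numeral)
  qed
  have "of_int (F j) * sn ((2 * j + 1) * K) * cs K = of_int (F j) * (cs K * sn ((2 * j + 1) * K))" for j
    by (simp only: mult_ac)
  then have 1: "sine_sum F K * cs K = (\<Sum>j<N. of_int (F j) * (cs K * sn ((2 * j + 1) * K)))"
    unfolding sine_sum_def sum_distrib_right by (intro sum.cong refl)
  have "[cs K * sn ((2 * j + 1) * K) = sn ((2 * j + 1) * K + K) + sn ((2 * j + 1) * K - K)] (mod m)" for j
    by (rule cs_mult_sn) simp
  moreover have "(2 * j + 1) * K + K = 2 * Suc j * K" "(2 * j + 1) * K - K = 2 * j * K" for j
    by simp_all
  ultimately have "[cs K * sn ((2 * j + 1) * K) = ?s (Suc j) + ?s j] (mod m)" for j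
    by (simp only:)
  then have 2: "[(\<Sum>j<N. of_int (F j) * (cs K * sn ((2 * j + 1) * K))) =
      (\<Sum>j<N. of_int (F j) * (?s (Suc j) + ?s j))] (mod m)"
    by (intro cong_sum cong_scalar_left)
  \<comment> \<open>Summation by regrouping: the lower boundary term is \<open>sn 0 = 0\<close>, and
    the upper one, at \<open>2 * N * K\<close>, vanishes by \<open>sn_half_period\<close>.\<close>
  have "(\<Sum>j<Suc M. of_int (F j) * (s (Suc j) + s j)) =
      (\<Sum>i<M. (of_int (F i) + of_int (F (Suc i))) * s (Suc i)) + of_int (F M) * s (Suc M)"
    if "s 0 = 0" for s :: "nat \<Rightarrow> 'a"
    using that by (induction M) (simp_all add: algebra_simps)
  from this[of ?s] have "(\<Sum>j<N. of_int (F j) * (?s (Suc j) + ?s j)) =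
      (\<Sum>i<M. (of_int (F i) + of_int (F (Suc i))) * ?s (Suc i)) + of_int (F M) * ?s N"
    by (simp add: M)
  also have "(\<Sum>i<M. (of_int (F i) + of_int (F (Suc i))) * ?s (Suc i)) = (\<Sum>i<M. 2 * of_int (?G i) * ?s (Suc i))"
    by (intro sum.cong refl) (simp only: G lessThan_iff)
  finally have 3: "(\<Sum>j<N. of_int (F j) * (?s (Suc j) + ?s j)) =
      (\<Sum>i<M. 2 * of_int (?G i) * ?s (Suc i)) + of_int (F M) * ?s N" .
  have 4: "[(\<Sum>i<M. 2 * of_int (?G i) * ?s (Suc i)) + of_int (F M) * ?s N =
      (\<Sum>i<M. 2 * of_int (?G i) * (sn (2 * K) * cheb_poly (cs (2 * K)) i)) + of_int (F M) * 0] (mod m)"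
    by (intro cong_add cong_scalar_left cong_sum cong_sym[OF cheb_poly_sn] sn_half_period)
  have "sn (2 * K) = sn K * cs K"
    unfolding mult_2[of K] power_add by (simp add: algebra_simps)
  then have 5: "(\<Sum>i<M. 2 * of_int (?G i) * (sn (2 * K) * cheb_poly (cs (2 * K)) i)) + of_int (F M) * 0 =
      (2 * sn K * ?q) * cs K"
    unfolding M diff_Suc_1 sum_distrib_left sum_distrib_right mult_zero_right add_0_right
    by (intro sum.cong refl) (simp only: mult_ac)
  have "[sine_sum F K * cs K = (2 * sn K * ?q) * cs K] (mod m)"
    using cong_trans[OF 2 4[folded 3]] unfolding 1 5 .
  then have "[sine_sum F K = 2 * sn K * ?q] (mod m)"
    by (rule cancel) (use cs_not_dvd[of K] assms(2) in \<open>simp add: K_def\<close>)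
  then show ?thesis by (simp only: K_def)
qed

text \<open>The factors left by \<open>sine_sum_eigenvalue\<close> are the eigenvalues of a single
  integer matrix, which depends on neither \<open>m\<close> nor \<xi>.\<close>

lemma prod_sine_sum:
  assumes "\<And>j. j < N \<Longrightarrow> odd (F j)"
  shows "[(\<Prod>k = 1..<N. sine_sum F k) = 2 ^ (N - 1) * (\<Prod>k = 1..<N. sn k) *
    of_int (det (mat (N - 1) (N - 1)
      (\<lambda>(j, l). \<Sum>i<N - 1. ((F i + F (Suc i)) div 2) * cheb (N - 1) i j l)))] (mod m)"
proof -
  let ?G = "\<lambda>i. (F i + F (Suc i)) div 2"
  let ?q = "\<lambda>k. \<Sum>i<N - 1. of_int (?G i) * cheb_poly (cs (2 * Suc k)) i"
  let ?B = "mat (N - 1) (N - 1) (\<lambda>(j, l). \<Sum>i<N - 1. ?G i * cheb (N - 1) i j l)"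
  have shift: "(\<Prod>k = 1..<N. h k) = (\<Prod>k<N - 1. h (Suc k))" for h :: "nat \<Rightarrow> 'a"
    by (rule prod.reindex_bij_witness[where i = Suc and j = "\<lambda>k. k - 1"]) auto
  have 1: "(\<Prod>k<N - 1. 2 * sn (Suc k) * ?q k) = 2 ^ (N - 1) * (\<Prod>k = 1..<N. sn k) * (\<Prod>k<N - 1. ?q k)"
    by (simp only: shift prod.distrib prod_constant card_lessThan)
  have "[(\<Prod>k = 1..<N. sine_sum F k) = (\<Prod>k<N - 1. 2 * sn (Suc k) * ?q k)] (mod m)"
    unfolding shift using assms by (intro cong_prod sine_sum_eigenvalue) auto
  note 2 = this[unfolded 1]
  have "[of_int (det ?B) = (\<Prod>k<N - 1. ?q k)] (mod m)"
  proof (rule det_eq_prod_eigenvalues)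
    fix j k assume *: "j < N - 1" "k < N - 1"
    have "(\<Sum>l<N - 1. of_int (\<Sum>i<N - 1. ?G i * cheb (N - 1) i j l) * sine l k) =
        (\<Sum>i<N - 1. of_int (?G i) * (\<Sum>l<N - 1. of_int (cheb (N - 1) i j l) * sine l k))"
      by (simp only: of_int_sum of_int_mult sum_distrib_right sum_distrib_left mult.assoc) (rule sum.swap)
    moreover have "[(\<Sum>i<N - 1. of_int (?G i) * (\<Sum>l<N - 1. of_int (cheb (N - 1) i j l) * sine l k)) =
        (\<Sum>i<N - 1. of_int (?G i) * (cheb_poly (cs (2 * Suc k)) i * sine j k))] (mod m)"
      using * by (intro cong_sum cong_scalar_left cheb_eigen)
    ultimately show "[(\<Sum>l<N - 1. of_int (\<Sum>i<N - 1. ?G i * cheb (N - 1) i j l) * sine l k) =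
        ?q k * sine j k] (mod m)"
      by (simp only: sum_distrib_right mult.assoc)
  qed
  then show ?thesis
    by (rule cong_trans[OF 2 cong_scalar_left[OF cong_sym]])
qed

text \<open>The square of \<open>sn k\<close> is \<open>cs (2 * k) - 2\<close>, an eigenvalue of A -
  2 for the adjacency matrix A of the path, whose determinant is known from
  \<open>det_path_minus_two\<close>.\<close>

lemma prod_sn_squared: "[(\<Prod>k = 1..<N. sn k) ^ 2 = (-1) ^ (N - 1) * of_nat N] (mod m)"
proof -
  let ?\<Delta> = "det (mat (N - 1) (N - 1) (\<lambda>(j, l). cheb (N - 1) (Suc 0) j l - 2 * cheb (N - 1) 0 j l))"
  have shift: "(\<Prod>k = 1..<N. sn k) ^ 2 = (\<Prod>k<N - 1. sn (Suc k) ^ 2)"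
    unfolding prod_power_distrib
    by (rule prod.reindex_bij_witness[where i = Suc and j = "\<lambda>k. k - 1"]) auto
  have "[sn k ^ 2 = cs (2 * k) - 2] (mod m)" for k
  proof -
    have "sn k ^ 2 = cs (2 * k) - 2 * (\<xi> ^ k * \<eta> ^ k)"
      unfolding mult_2[of k] power_add power2_eq_square by (simp add: algebra_simps)
    moreover have "[cs (2 * k) - 2 * (\<xi> ^ k * \<eta> ^ k) = cs (2 * k) - 2 * 1] (mod m)"
      by (intro cong_diff cong_scalar_left inverse_pow cong_refl)
    ultimately show ?thesis by (simp only: mult_1_right)
  qed
  then have 1: "[(\<Prod>k = 1..<N. sn k) ^ 2 = (\<Prod>k<N - 1. cs (2 * Suc k) - 2)] (mod m)"
    unfolding shift by (intro cong_prod)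
  have 2: "[(\<Prod>k<N - 1. cs (2 * Suc k) - 2) = of_int ?\<Delta>] (mod m)"
  proof (rule cong_sym[OF det_eq_prod_eigenvalues])
    fix j k assume *: "j < N - 1" "k < N - 1"
    have "(\<Sum>l<N - 1. of_int (cheb (N - 1) (Suc 0) j l - 2 * cheb (N - 1) 0 j l) * sine l k) =
        (\<Sum>l<N - 1. of_int (cheb (N - 1) (Suc 0) j l) * sine l k) -
        2 * (\<Sum>l<N - 1. of_int (cheb (N - 1) 0 j l) * sine l k)"
      by (simp only: of_int_diff of_int_mult of_int_numeral left_diff_distrib sum_subtractf
          sum_distrib_left mult.assoc)
    moreover have "[(\<Sum>l<N - 1. of_int (cheb (N - 1) (Suc 0) j l) * sine l k) -
        2 * (\<Sum>l<N - 1. of_int (cheb (N - 1) 0 j l) * sine l k) =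
        cheb_poly (cs (2 * Suc k)) (Suc 0) * sine j k - 2 * (cheb_poly (cs (2 * Suc k)) 0 * sine j k)] (mod m)"
      using * by (intro cong_diff cong_scalar_left cheb_eigen)
    ultimately show "[(\<Sum>l<N - 1. of_int (cheb (N - 1) (Suc 0) j l - 2 * cheb (N - 1) 0 j l) * sine l k) =
        (cs (2 * Suc k) - 2) * sine j k] (mod m)"
      by (simp only: cheb_poly.simps left_diff_distrib mult_1_left)
  qed
  have 3: "of_int ?\<Delta> = ((-1) ^ (N - 1) * of_nat N :: 'a)"
    unfolding det_path_minus_two using N_pos by (simp add: of_nat_diff)
  show ?thesis
    using cong_trans[OF 1 2] unfolding 3 .
qed

text \<open>Under a -> 4N - a the sine changes sign and \<open>f\<close> is multiplied by (-1)^a: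
  terms with even a cancel and those with odd a double. The fixed point a = 2N has vanishing
  sine.\<close>

lemma sum_full_period:
  assumes "f 0 = 0" and refl: "\<And>a. 0 < a \<Longrightarrow> a < 4 * N \<Longrightarrow> f (4 * N - a) = (-1) ^ a * f a"
  shows "[(\<Sum>a<4*N. of_int (f a) * sn (a * k)) = 2 * sine_sum (\<lambda>j. f (2 * j + 1)) k] (mod m)"
proof -
  let ?t = "\<lambda>a. of_int (f a) * sn (a * k)"
  have "(\<Sum>a<4*N. ?t a) = (\<Sum>a<2*N. ?t a) + (\<Sum>a = 2*N..<4*N. ?t a)"
    using sum.atLeastLessThan_concat[of 0 "2 * N" "4 * N" ?t] by (simp add: atLeast0LessThan)
  also have "(\<Sum>a = 2*N..<4*N. ?t a) = ?t (2*N) + (\<Sum>a = 2*N + 1..<4*N. ?t a)"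
    using N_pos by (subst sum.atLeast_Suc_lessThan) auto
  also have "(\<Sum>a = 2*N + 1..<4*N. ?t a) = (\<Sum>a = 1..<2*N. ?t (4*N - a))"
    by (rule sum.reindex_bij_witness[where i = "\<lambda>a. 4*N - a" and j = "\<lambda>a. 4*N - a"]) auto
  finally have 1: "(\<Sum>a<4*N. ?t a) = (\<Sum>a<2*N. ?t a) + (?t (2*N) + (\<Sum>a = 1..<2*N. ?t (4*N - a)))" .
  have "[?t (4*N - a) = - ((-1) ^ a * ?t a)] (mod m)" if "a \<in> {1..<2*N}" for a
  proof -
    have a: "0 < a" "a \<le> 4 * N" "a < 4 * N" using that by auto
    have "of_int (f (4*N - a)) = ((-1) ^ a * of_int (f a) :: 'a)"
      using refl[OF a(1) a(3)] by simp
    moreover have "- ((-1) ^ a * ?t a) = (-1) ^ a * of_int (f a) * (\<eta> ^ (a * k) - \<xi> ^ (a * k))"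
      by (simp add: algebra_simps)
    moreover have "[sn ((4*N - a) * k) = \<eta> ^ (a * k) - \<xi> ^ (a * k)] (mod m)"
      by (intro cong_diff full_period_diff a)
    ultimately show ?thesis
      by (simp only: cong_scalar_left)
  qed
  then have 2: "[(\<Sum>a<2*N. ?t a) + (?t (2*N) + (\<Sum>a = 1..<2*N. ?t (4*N - a))) =
      (\<Sum>a<2*N. ?t a) + (of_int (f (2*N)) * 0 + (\<Sum>a = 1..<2*N. - ((-1) ^ a * ?t a)))] (mod m)"
    by (intro cong_add cong_refl cong_scalar_left cong_sum sn_half_period)
  have "(\<Sum>a<2*N. - ((-1) ^ a * ?t a)) = (\<Sum>a = 1..<2*N. - ((-1) ^ a * ?t a))"
    using N_pos assms(1) sum.atLeast_Suc_lessThan[of 0 "2 * N" "\<lambda>a. - ((-1) ^ a * ?t a)"]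
    by (simp add: atLeast0LessThan)
  then have "(\<Sum>a<2*N. ?t a) + (of_int (f (2*N)) * 0 + (\<Sum>a = 1..<2*N. - ((-1) ^ a * ?t a))) =
      (\<Sum>a<2*N. (1 - (-1) ^ a) * ?t a)"
    by (simp only: left_diff_distrib sum_subtractf sum_negf mult_1_left) simp
  also have "\<dots> = (\<Sum>j<N. 2 * ?t (2 * j + 1))"
  proof -
    have "(\<Sum>a<2*n. (1 - (-1) ^ a) * h a) = (\<Sum>j<n. 2 * h (2 * j + 1))" for n and h :: "nat \<Rightarrow> 'a"
      by (induction n) (auto simp: algebra_simps)
    then show ?thesis .
  qed
  also have "\<dots> = 2 * sine_sum (\<lambda>j. f (2 * j + 1)) k"
    by (simp only: sine_sum_def sum_distrib_left)
  finally have 3: "(\<Sum>a<2*N. ?t a) + (of_int (f (2*N)) * 0 + (\<Sum>a = 1..<2*N. - ((-1) ^ a * ?t a))) =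
    2 * sine_sum (\<lambda>j. f (2 * j + 1)) k" .
  show ?thesis
    using 2 unfolding 1 3 .
qed

end

subsection \<open>The Legendre symbol of the determinant\<close>

locale prime_primroot =
  fixes p N g :: nat
  assumes prime: "prime p" and p_eq: "p = 4 * N + 1" and primroot: "residue_primroot p g"
begin

section \<open>The Legendre symbol through Euler's criterion, and powers of a primitive root\<close>

abbreviation L :: "int \<Rightarrow> int" where "L x \<equiv> Legendre x (int p)"

lemma N_pos: "N > 0" and p_gt_2: "p > 2"
  using prime p_eq by (cases N; auto)+

lemma Legendre_cong:
  assumes "[x = y] (mod int p)"
  shows "L x = L y"
proof -
  have "[z = x] (mod int p) \<longleftrightarrow> [z = y] (mod int p)" for z
    using assms cong_sym cong_trans by blast
  moreover have "[x = 0] (mod int p) \<longleftrightarrow> [y = 0] (mod int p)"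
    using assms cong_sym cong_trans by blast
  ultimately show ?thesis unfolding Legendre_def QuadRes_def by simp
qed

lemma euler: "[L x = x ^ (2 * N)] (mod int p)"
  using euler_criterion[OF prime p_gt_2, of x] p_eq by simp

lemma Legendre_cases: "L x = 0 \<or> L x = 1 \<or> L x = -1"
  by (simp add: Legendre_def)

lemma eq_of_cong:
  assumes "[a = b] (mod int p)" "\<bar>a\<bar> \<le> 1" "\<bar>b\<bar> \<le> 1"
  shows "a = b"
proof -
  have "int p dvd a - b" using assms(1) by (simp add: cong_iff_dvd_diff)
  moreover have "\<bar>a - b\<bar> < int p" using assms p_gt_2 by linarith
  ultimately show ?thesis using dvd_imp_le_int[of "a - b" "int p"] by fastforce
qed

lemma Legendre_abs: "\<bar>L x\<bar> \<le> 1"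
  by (simp add: Legendre_def)

lemma Legendre_eqI: "[x ^ (2 * N) = e] (mod int p) \<Longrightarrow> \<bar>e\<bar> \<le> 1 \<Longrightarrow> L x = e"
  using eq_of_cong Legendre_abs euler cong_trans by metis

lemma Legendre_mult: "L (x * y) = L x * L y"
proof (rule Legendre_eqI)
  show "[(x * y) ^ (2 * N) = L x * L y] (mod int p)"
    unfolding power_mult_distrib by (intro cong_mult cong_sym[OF euler])
  show "\<bar>L x * L y\<bar> \<le> 1"
    using Legendre_cases[of x] Legendre_cases[of y] by auto
qed

lemma Legendre_1: "L 1 = 1"
  by (rule Legendre_eqI) auto

lemma Legendre_power: "L (x ^ k) = L x ^ k"
  by (induction k) (simp_all add: Legendre_1 Legendre_mult)

lemma Legendre_prod: "L (prod f A) = (\<Prod>x\<in>A. L (f x))"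
  by (induction A rule: infinite_finite_induct) (simp_all add: Legendre_1 Legendre_mult)

lemma Legendre_eq_0_iff: "L x = 0 \<longleftrightarrow> int p dvd x"
  by (simp add: Legendre_def cong_0_iff)

lemma Legendre_square: "\<not> int p dvd x \<Longrightarrow> L x * L x = 1"
  using Legendre_cases[of x] Legendre_eq_0_iff[of x] by auto

lemma Legendre_neg1: "L (-1) = 1"
  by (rule Legendre_eqI) auto

lemma Legendre_minus: "L (- x) = L x"
  using Legendre_mult[of "-1" x] Legendre_neg1 by simp

lemma prime_int: "prime (int p)"
  using prime by simp

lemma dvd_mult_cases: "int p dvd a * b \<Longrightarrow> int p dvd a \<or> int p dvd b"
  using prime_int by (simp add: prime_dvd_mult_iff)

lemma g_ord: "ord p g = 4 * N"
  using primroot prime p_eq by (simp add: residue_primroot_def totient_prime)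

lemma g_power_eq_1_iff: "[int g ^ k = 1] (mod int p) \<longleftrightarrow> 4 * N dvd k"
  using ord_divides[of g k p] cong_int_iff[of "g ^ k" 1 p] g_ord by simp

lemma g_power_half: "[int g ^ (2 * N) = -1] (mod int p)"
proof -
  have "[int g ^ (4 * N) = 1] (mod int p)"
    by (simp add: g_power_eq_1_iff)
  moreover have "int g ^ (4 * N) - 1 = (int g ^ (2 * N) - 1) * (int g ^ (2 * N) + 1)"
    by (simp add: algebra_simps flip: power_add mult_2)
  ultimately have "int p dvd (int g ^ (2 * N) - 1) * (int g ^ (2 * N) + 1)"
    by (simp add: cong_iff_dvd_diff)
  moreover have "\<not> int p dvd int g ^ (2 * N) - 1"
    using g_power_eq_1_iff[of "2 * N"] N_pos by (auto simp: cong_iff_dvd_diff dest: dvd_imp_le)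
  ultimately show ?thesis
    using dvd_mult_cases by (auto simp: cong_iff_dvd_diff)
qed

lemma g_not_dvd: "\<not> int p dvd int g ^ k"
proof
  assume "int p dvd int g ^ k"
  then have "int p dvd int g" using prime_int prime_dvd_power by blast
  moreover have "int g dvd int g ^ (4 * N)" using N_pos by (intro dvd_power) simp
  ultimately have *: "int p dvd int g ^ (4 * N)" by (rule dvd_trans)
  have "[int g ^ (4 * N) = 1] (mod int p)"
    by (simp add: g_power_eq_1_iff)
  from iffD1[OF cong_dvd_iff[OF this] *] have "int p dvd 1" .
  then show False using p_gt_2 by simp
qed

lemma Legendre_g: "L (int g) = -1"
  by (rule Legendre_eqI) (use g_power_half in auto)

lemma small_not_dvd: "0 < k \<Longrightarrow> k < p \<Longrightarrow> \<not> int p dvd int k"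
  by (auto dest: zdvd_imp_le)

text \<open>By Fermat the inverse of \<open>g\<close> modulo \<open>p\<close> is a power of
  \<open>g\<close>, which serves as \<eta>.\<close>

lemma root_mod_int: "root_mod (int p) (int g) (int g ^ (4 * N - 1)) N"
proof
  show "int p dvd a \<or> int p dvd b" if "int p dvd a * b" for a b
    using dvd_mult_cases that .
  show "[int g * int g ^ (4 * N - 1) = 1] (mod int p)"
    using g_power_eq_1_iff[of "4 * N"] N_pos by (simp flip: power_Suc)
  show "\<not> [int g ^ (2 * t) = 1] (mod int p)" if "0 < t" "t < 2 * N" for t
    using that by (auto simp: g_power_eq_1_iff dest: dvd_imp_le)
  show "\<not> int p dvd of_nat (2 * N)"
    using small_not_dvd[of "2 * N"] N_pos p_eq by simp
qed (use N_pos g_power_half in auto)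

definition f :: "nat \<Rightarrow> int" where "f a = L (1 - int g ^ a)"

lemma f_0: "f 0 = 0"
  by (simp add: f_def Legendre_def)

lemma f_cong: "[a = b] (mod 4 * N) \<Longrightarrow> f a = f b"
proof -
  assume "[a = b] (mod 4 * N)"
  then have "[g ^ a = g ^ b] (mod p)"
    using order_divides_expdiff[of p g a b] g_ord primroot by (simp add: residue_primroot_def coprime_commute)
  then have "[int g ^ a = int g ^ b] (mod int p)"
    using cong_int_iff[of "g ^ a" "g ^ b" p] by simp
  then show ?thesis
    unfolding f_def by (intro Legendre_cong cong_diff) auto
qed

text \<open>Modulo \<open>p\<close>, g^a * (1 - g^(-a)) = -(1 - g^a). Here -1 is a square and
  \<open>g\<close> is a nonsquare.\<close>

lemma f_refl:
  assumes "a \<le> 4 * N"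
  shows "f (4 * N - a) = (-1) ^ a * f a"
proof -
  have "int g ^ a * (1 - int g ^ (4 * N - a)) = int g ^ a - int g ^ (4 * N)"
    using assms by (simp add: algebra_simps flip: power_add)
  also have "[int g ^ a - int g ^ (4 * N) = int g ^ a - 1] (mod int p)"
    by (intro cong_diff) (simp_all add: g_power_eq_1_iff)
  finally have "L (int g ^ a * (1 - int g ^ (4 * N - a))) = L (- (1 - int g ^ a))"
    by (intro Legendre_cong) simp
  then have "(-1) ^ a * f (4 * N - a) = f a"
    by (simp only: Legendre_mult Legendre_power Legendre_g Legendre_minus f_def)
  then have "(-1) ^ a * ((-1) ^ a * f (4 * N - a)) = (-1) ^ a * f a" by simp
  then show ?thesis by (simp add: mult.assoc[symmetric] flip: power_add)
qed

lemma f_odd: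
  assumes "\<not> 4 * N dvd a"
  shows "odd (f a)" "f a * f a = 1"
proof -
  have "\<not> int p dvd 1 - int g ^ a"
    using assms g_power_eq_1_iff[of a] by (simp add: cong_iff_dvd_diff dvd_diff_commute)
  then have "f a \<noteq> 0" by (simp add: f_def Legendre_eq_0_iff)
  then show "odd (f a)" "f a * f a = 1"
    using Legendre_cases[of "1 - int g ^ a"] by (auto simp: f_def)
qed

text \<open>The sum of the e-th powers of all nonzero residues, written in powers of
  \<open>g\<close>.\<close>

lemma power_sum_g: "[(\<Sum>a<4*N. int g ^ (a * e)) = (if 4 * N dvd e then -1 else 0)] (mod int p)"
proof (cases "4 * N dvd e")
  case True
  then have "[(\<Sum>a<4*N. int g ^ (a * e)) = (\<Sum>a<4*N. 1)] (mod int p)"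
    by (intro cong_sum) (simp add: g_power_eq_1_iff)
  moreover have "(\<Sum>a<4*N. 1) - (- 1) = int p"
    by (simp add: p_eq)
  then have "[(\<Sum>a<4*N. 1) = - 1] (mod int p)"
    by (simp only: cong_iff_dvd_diff dvd_refl)
  ultimately show ?thesis using True cong_trans by simp
next
  case False
  let ?S = "\<Sum>a<4*N. (int g ^ e) ^ a"
  have "(int g ^ e - 1) * ?S = (int g ^ e) ^ (4 * N) - 1"
    by (simp add: power_diff_1_eq)
  moreover have "[(int g ^ e) ^ (4 * N) = 1] (mod int p)"
    by (simp add: g_power_eq_1_iff flip: power_mult)
  ultimately have "int p dvd (int g ^ e - 1) * ?S"
    by (simp add: cong_iff_dvd_diff)
  moreover have "\<not> int p dvd int g ^ e - 1"
    using False g_power_eq_1_iff[of e] by (simp add: cong_iff_dvd_diff)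
  ultimately have "int p dvd ?S" using dvd_mult_cases by blast
  then show ?thesis
    using False by (simp add: cong_0_iff power_mult[symmetric] mult.commute)
qed

interpretation M: root_mod "int p" "int g" "int g ^ (4 * N - 1)" N
  by (rule root_mod_int)

text \<open>Modulo \<open>p\<close> the Legendre symbol is a power, so the sums become power sums over the field.\<close>
lemma double_sine_sum_cong:
  assumes "0 < k" "k < N"
  shows "[2 * M.sine_sum (\<lambda>j. f (2 * j + 1)) k = (-1) ^ k * int ((2 * N) choose k)] (mod int p)"
proof -
  let ?c = "\<lambda>i. int ((2 * N) choose i) * (-1) ^ i"
  let ?P = "\<lambda>e. \<Sum>a<4*N. int g ^ (a * e)"
  have 1: "[(\<Sum>a<4*N. f a * (int g ^ (a * k) - (int g ^ (4 * N - 1)) ^ (a * k))) =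
      2 * M.sine_sum (\<lambda>j. f (2 * j + 1)) k] (mod int p)"
    using M.sum_full_period[of f k] f_0 f_refl by simp
  \<comment> \<open>Euler's criterion turns \<open>f a\<close> into (1 - g^a)^(2N), to be expanded
    binomially. The exponent \<open>4 * N - k\<close> stands for -k.\<close>
  have "[f a * (int g ^ (a * k) - (int g ^ (4 * N - 1)) ^ (a * k)) =
      (\<Sum>i\<le>2*N. ?c i * (int g ^ (a * (i + k)) - int g ^ (a * (i + (4 * N - k)))))] (mod int p)" for a
  proof -
    have "[(int g ^ (4 * N - 1)) ^ (a * k) = int g ^ (a * (4 * N - k))] (mod int p)"
      using cong_sym[OF M.full_period_diff(1)[of k a]] assms by (simp add: mult.commute)
    then have "[f a * (int g ^ (a * k) - (int g ^ (4 * N - 1)) ^ (a * k)) =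
        (1 - int g ^ a) ^ (2 * N) * (int g ^ (a * k) - int g ^ (a * (4 * N - k)))] (mod int p)"
      unfolding f_def by (intro cong_mult euler cong_diff cong_refl)
    moreover have "(1 - int g ^ a) ^ (2 * N) = (\<Sum>i\<le>2*N. ?c i * int g ^ (a * i))"
      using binomial_ring[of "- (int g ^ a)" 1 "2 * N"]
      by (simp add: power_minus[of "int g ^ a"] mult.assoc flip: power_mult)
    ultimately show ?thesis
      by (simp only: sum_distrib_right mult.assoc right_diff_distrib power_add distrib_left sum_subtractf)
  qed
  then have 2: "[(\<Sum>a<4*N. f a * (int g ^ (a * k) - (int g ^ (4 * N - 1)) ^ (a * k))) =
      (\<Sum>a<4*N. \<Sum>i\<le>2*N. ?c i * (int g ^ (a * (i + k)) - int g ^ (a * (i + (4 * N - k)))))] (mod int p)"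
    by (intro cong_sum)
  have 3: "(\<Sum>a<4*N. \<Sum>i\<le>2*N. ?c i * (int g ^ (a * (i + k)) - int g ^ (a * (i + (4 * N - k))))) =
      (\<Sum>i\<le>2*N. ?c i * (?P (i + k) - ?P (i + (4 * N - k))))"
    by (subst sum.swap) (simp only: sum_distrib_left sum_subtractf[symmetric])
  \<comment> \<open>Only one power sum survives: i + k lies strictly between 0 and 4N, while i - k
    is divisible by 4N only for i = k.\<close>
  have "[?P (i + k) = 0] (mod int p)" if "i \<le> 2 * N" for i
    using power_sum_g[of "i + k"] that assms by (auto split: if_splits dest!: dvd_imp_le)
  moreover have "4 * N dvd i + (4 * N - k) \<longleftrightarrow> i = k" if "i \<le> 2 * N" for i
  proof
    assume "4 * N dvd i + (4 * N - k)"
    then obtain q where q: "i + (4 * N - k) = 4 * N * q" by (elim dvdE)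
    have "0 < i + (4 * N - k)" "i + (4 * N - k) < 4 * N * 2" using that assms by linarith+
    then have "0 < q" "q < 2" unfolding q using mult_less_cancel1[of "4 * N" q 2] by auto
    then have "q = 1" by simp
    then show "i = k" using q assms by simp
  qed (use assms in simp)
  then have "[?P (i + (4 * N - k)) = (if i = k then -1 else 0)] (mod int p)" if "i \<le> 2 * N" for i
    using power_sum_g[of "i + (4 * N - k)"] that by simp
  ultimately have 4: "[(\<Sum>i\<le>2*N. ?c i * (?P (i + k) - ?P (i + (4 * N - k)))) =
      (\<Sum>i\<le>2*N. ?c i * (0 - (if i = k then -1 else 0)))] (mod int p)"
    by (intro cong_sum cong_scalar_left cong_diff) auto
  have 5: "(\<Sum>i\<le>2*N. ?c i * (0 - (if i = k then -1 else 0))) = ?c k"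
    using assms by (subst sum.remove[of _ k]) auto
  show ?thesis
    using cong_trans[OF cong_sym[OF 1] cong_trans[OF 2[unfolded 3] 4[unfolded 5]]]
    by (simp only: mult.commute)
qed

text \<open>With I = g^N, a square root of -1, one has (1 + I)^2 = 2I, so 2 and g^N have the same
  symbol.\<close>

lemma Legendre_2: "L 2 = (-1) ^ N"
proof -
  let ?I = "int g ^ N"
  have I2: "[?I * ?I = -1] (mod int p)"
    using g_power_half by (simp add: mult_2 power_add)
  have nd: "\<not> int p dvd 1 + ?I"
  proof
    assume "int p dvd 1 + ?I"
    then have "int p dvd (1 + ?I) * (?I - 1)" by simp
    then have "[?I * ?I = 1] (mod int p)" by (simp add: cong_iff_dvd_diff algebra_simps)
    then have "[-1 = 1] (mod int p)" using I2 cong_sym cong_trans by blast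
    then show False using eq_of_cong[of "-1" 1] by simp
  qed
  have "[(1 + ?I) * (1 + ?I) = 2 * ?I] (mod int p)"
    using I2 by (simp add: cong_iff_dvd_diff algebra_simps)
  then have "L 2 * (-1) ^ N = 1"
    using Legendre_cong Legendre_square[OF nd] by (fastforce simp: Legendre_mult Legendre_power Legendre_g)
  then show ?thesis by (cases "even N") auto
qed

lemma Legendre_2_square: "L 2 * L 2 = 1"
  by (simp add: Legendre_2 flip: power_add)

text \<open>Pairing i with p - i in Wilson's theorem gives ((2N)!)^2 = -1 modulo \<open>p\<close>;
  the N-th power of this is Euler's criterion for (2N)!.\<close>

lemma Legendre_fact: "L (fact (2 * N)) = (-1) ^ N"
proof -
  have fact_eq: "fact n = (\<Prod>i = 1..n. int i)" for n
    by (simp add: fact_prod)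
  have "{1..4*N} = {1..2*N} \<union> {2*N + 1..4*N}" by auto
  then have "fact (4 * N) = fact (2 * N) * (\<Prod>i = 2*N + 1..4*N. int i)"
    unfolding fact_eq by (simp only:) (rule prod.union_disjoint, auto)
  also have "(\<Prod>i = 2*N + 1..4*N. int i) = (\<Prod>j = 1..2*N. int p - int j)"
    by (rule prod.reindex_bij_witness[where i = "\<lambda>i. p - i" and j = "\<lambda>i. p - i"]) (auto simp: p_eq)
  finally have 1: "fact (4 * N) = fact (2 * N) * (\<Prod>j = 1..2*N. int p - int j)" .
  have "(\<Prod>j = 1..2*N. - int j) = fact (2 * N)"
    unfolding fact_eq by (simp add: prod_uminus)
  moreover have "[(\<Prod>j = 1..2*N. int p - int j) = (\<Prod>j = 1..2*N. - int j)] (mod int p)"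
    by (intro cong_prod) (simp add: cong_iff_dvd_diff)
  ultimately have "[fact (4 * N) = (fact (2 * N)) ^ 2] (mod int p)"
    unfolding 1 power2_eq_square by (simp only: cong_scalar_left)
  moreover have "[fact (4 * N) = (-1 :: int)] (mod int p)"
    using wilson_theorem[OF prime] p_eq by simp
  ultimately have "[fact (2 * N) ^ 2 = (-1 :: int)] (mod int p)"
    using cong_sym cong_trans by blast
  then have "[(fact (2 * N) ^ 2) ^ N = (-1 :: int) ^ N] (mod int p)"
    by (rule cong_pow)
  then show ?thesis
    by (intro Legendre_eqI) (simp_all only: power_mult power_abs abs_minus_cancel abs_one power_one order_refl)
qed

text \<open>Each binomial coefficient is (2N)! divided by k! (2N - k)!. The denominators run over
  the factorials of 1, ..., 2N - 1 except N!, and the product of all factorials up to (2N)! is 2^N *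
  N! up to a square. The remaining signs are powers of (-1)^N and cancel.\<close>

lemma Legendre_central_prod: "(\<Prod>k = 1..<N. L (int ((2 * N) choose k))) = 1"
proof -
  define e where "e = L (fact (2 * N))"
  have fact_nd: "\<not> int p dvd fact j" if "j \<le> 2 * N" for j
    using that prime_dvd_fact_iff[OF prime, of j] int_dvd_int_iff[of p "fact j"] p_eq by simp
  define Q where "Q = (\<Prod>k = 1..<N. L (fact k) * L (fact (2 * N - k)))"
  have "L (int ((2 * N) choose k)) * (L (fact k) * L (fact (2 * N - k))) = e" if "k < N" for k
  proof -
    have "fact k * fact (2 * N - k) * ((2 * N) choose k) = (fact (2 * N) :: nat)"
      using that by (intro binomial_fact_lemma) simp
    from arg_cong[OF this, of int] have "int ((2 * N) choose k) * (fact k * fact (2 * N - k)) = fact (2 * N)"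
      by (simp add: mult_ac)
    then show ?thesis by (simp only: e_def Legendre_mult[symmetric])
  qed
  then have 1: "(\<Prod>k = 1..<N. L (int ((2 * N) choose k))) * Q = e ^ (N - 1)"
    unfolding Q_def prod.distrib[symmetric] by (simp add: prod_constant)
  \<comment> \<open>Consecutive factorials are paired: (2j - 1)! (2j)! = ((2j - 1)!)^2 * 2j.\<close>
  have "(\<Prod>k = 1..2*n. fact k :: int) = (\<Prod>j = 1..n. fact (2 * j - 1)) ^ 2 * (2 ^ n * fact n)" for n
    by (induction n) (simp_all add: algebra_simps power2_eq_square)
  from arg_cong[OF this[of N], of L]
  have "(\<Prod>k = 1..2*N. L (fact k)) = L ((\<Prod>j = 1..N. fact (2 * j - 1)) ^ 2) * (L 2 ^ N * L (fact N))"
    by (simp only: Legendre_mult[of "_ ^ 2"] Legendre_mult[of "2 ^ N"] Legendre_power[of 2] Legendre_prod[of _ "{1..2*N}"])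
  also have "L ((\<Prod>j = 1..N. fact (2 * j - 1)) ^ 2) = (\<Prod>j = 1..N. L (fact (2 * j - 1)) * L (fact (2 * j - 1)))"
    by (simp add: power2_eq_square Legendre_mult Legendre_prod prod.distrib)
  also have "\<dots> = 1"
    by (intro prod.neutral ballI Legendre_square fact_nd) auto
  finally have 2: "(\<Prod>k = 1..2*N. L (fact k)) = L 2 ^ N * L (fact N)" by simp
  let ?h = "\<lambda>k. L (fact k)"
  let ?A = "{1..<N}" and ?B = "{N+1..<2*N}"
  have "{1..2*N} = ?A \<union> ({N} \<union> (?B \<union> {2 * N}))"
    using N_pos by auto
  then have "prod ?h {1..2*N} = prod ?h (?A \<union> ({N} \<union> (?B \<union> {2 * N})))"
    by (rule arg_cong)
  also have "\<dots> = prod ?h ?A * prod ?h ({N} \<union> (?B \<union> {2 * N}))"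
    by (rule prod.union_disjoint) auto
  also have "prod ?h ({N} \<union> (?B \<union> {2 * N})) = ?h N * prod ?h (?B \<union> {2 * N})"
    using N_pos by (subst prod.union_disjoint) auto
  also have "prod ?h (?B \<union> {2 * N}) = prod ?h ?B * e"
    unfolding e_def by (subst prod.union_disjoint) auto
  also have "(\<Prod>k = N+1..<2*N. L (fact k)) = (\<Prod>k = 1..<N. L (fact (2 * N - k)))"
    by (rule prod.reindex_bij_witness[where i = "\<lambda>k. 2 * N - k" and j = "\<lambda>k. 2 * N - k"]) auto
  finally have "Q * e * L (fact N) = L 2 ^ N * L (fact N)"
    unfolding 2 Q_def prod.distrib by (simp only: mult_ac)
  moreover have "L (fact N) \<noteq> 0"
    using fact_nd[of N] by (simp add: Legendre_eq_0_iff)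
  ultimately have "Q * e = L 2 ^ N" by simp
  moreover have "e = (-1) ^ N"
    by (simp add: e_def Legendre_fact)
  ultimately have "Q = 1" "e ^ (N - 1) = 1"
    unfolding Legendre_2 using N_pos by (cases "even N"; simp)+
  then show ?thesis using 1 by simp
qed

text \<open>In \<open>prod_sine_sum\<close> modulo \<open>p\<close>, doubling each sine sum yields
  signed binomial coefficients, whose symbols multiply to 1. The two powers of 2 combine to a
  square, so only the symbol of the product \<open>P\<close> of sines remains; it is found from
  \<open>P^2\<close>.\<close>

lemma Legendre_det_chebyshev:
  "L (det (mat (N - 1) (N - 1) (\<lambda>(j, l).
     \<Sum>i<N - 1. ((f (2 * i + 1) + f (2 * Suc i + 1)) div 2) * cheb (N - 1) i j l))) = 1"
    (is "L ?D = 1")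
proof -
  let ?F = "\<lambda>j. f (2 * j + 1)"
  let ?S = "\<lambda>k. M.sine_sum ?F k"
  define P where "P = (\<Prod>k = 1..<N. M.sn k)"
  have "odd (?F j)" if "j < N" for j
    using that by (intro f_odd) (auto dest!: dvd_imp_le)
  from M.prod_sine_sum[of ?F, OF this]
  have "[(\<Prod>k = 1..<N. ?S k) = 2 ^ (N - 1) * P * ?D] (mod int p)"
    by (simp add: P_def)
  then have "L (\<Prod>k = 1..<N. ?S k) = L (2 ^ (N - 1) * P * ?D)"
    by (rule Legendre_cong)
  then have 1: "(\<Prod>k = 1..<N. L (?S k)) = L 2 ^ (N - 1) * L P * L ?D"
    by (simp only: Legendre_mult Legendre_power Legendre_prod)
  have "L 2 * L (?S k) = L (int ((2 * N) choose k))" if "0 < k" "k < N" for k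
  proof -
    have "L 2 * L (?S k) = L ((-1) ^ k * int ((2 * N) choose k))"
      using Legendre_cong[OF double_sine_sum_cong[OF that]] by (simp only: Legendre_mult)
    then show ?thesis by (simp only: Legendre_mult Legendre_power Legendre_neg1 power_one mult_1_left)
  qed
  then have "(\<Prod>k = 1..<N. L 2 * L (?S k)) = 1"
    using Legendre_central_prod by simp
  then have "L 2 ^ (N - 1) * (L 2 ^ (N - 1) * L P * L ?D) = 1"
    by (simp only: prod.distrib 1 prod_constant card_atLeastLessThan)
  moreover have "L 2 ^ (N - 1) * L 2 ^ (N - 1) = 1"
    by (simp add: Legendre_2_square flip: power_mult_distrib)
  moreover have "a * (a * x * y) = (a * a) * (x * y)" for a x y :: int by simp
  ultimately have 2: "L P * L ?D = 1"
    by (simp only: mult_1_left)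
  \<comment> \<open>As 4N = -1 modulo \<open>p\<close>, (2P)^2 is (-1)^N. Its N-th power is Euler's
    criterion for 2P, and 2 has the same symbol.\<close>
  have "[(2 * P) ^ 2 = 4 * ((-1) ^ (N - 1) * int N)] (mod int p)"
    unfolding power_mult_distrib using M.prod_sn_squared by (intro cong_mult) (simp_all add: P_def)
  moreover have "4 * ((-1) ^ (N - 1) * int N) - (-1) ^ N = (-1) ^ (N - 1) * int p"
    using N_pos by (cases N) (simp_all add: p_eq algebra_simps)
  then have "[4 * ((-1) ^ (N - 1) * int N) = (-1) ^ N] (mod int p)"
    by (simp only: cong_iff_dvd_diff dvd_triv_right)
  ultimately have "[((2 * P) ^ 2) ^ N = ((-1) ^ N) ^ N] (mod int p)"
    by (intro cong_pow) (rule cong_trans)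
  moreover have "((-1) ^ N) ^ N = (-1 :: int) ^ N"
    by (cases "even N") auto
  ultimately have "L (2 * P) = (-1) ^ N"
    by (intro Legendre_eqI) (simp_all only: power_mult power_abs abs_minus_cancel abs_one power_one order_refl)
  then have "L P = 1"
    by (simp add: Legendre_mult Legendre_2)
  then show ?thesis using 2 by simp
qed

end

subsection \<open>Complex sums\<close>

lemma sum_periodic_shift:
  fixes h :: "nat \<Rightarrow> 'a :: ab_group_add"
  assumes "\<And>t. h (t + n) = h t"
  shows "(\<Sum>t<n. h (t + b)) = (\<Sum>t<n. h t)"
proof (induction b)
  case (Suc b)
  have "(\<Sum>t<Suc n. h (t + b)) = (\<Sum>t<n. h (t + b)) + h b"
    using assms[of b] by (simp add: add.commute)
  moreover have "(\<Sum>t<Suc n. h (t + b)) = h b + (\<Sum>t<n. h (t + Suc b))"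
    by (subst sum.lessThan_Suc_shift) simp
  ultimately have "(\<Sum>t<n. h (t + Suc b)) = (\<Sum>t<n. h (t + b))"
    by (simp add: add.commute)
  then show ?case using Suc by simp
qed simp

text \<open>Uniqueness of a prime as a sum of two squares. The prime divides one of xv - yu and xv +
  yu; call it \<open>w\<close>. Brahmagupta's identity completes \<open>w\<close> to w^2 + w'^2 =
  q^2, and \<open>w = 0\<close> follows by size.\<close>

lemma sum_squares_unique:
  fixes x y u v :: int
  assumes "prime q" "x\<^sup>2 + y\<^sup>2 = q" "u\<^sup>2 + v\<^sup>2 = q" "odd x" "odd u" "odd q"
  shows "y\<^sup>2 = v\<^sup>2"
proof -
  have evens: "even y" "even v"
    using assms by (metis even_add even_power odd_add power2_eq_square even_mult_iff)+
  have squares: "x\<^sup>2 = q - y\<^sup>2" "u\<^sup>2 = q - v\<^sup>2" using assms(2,3) by auto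
  have "(x * v - y * u) * (x * v + y * u) = x\<^sup>2 * v\<^sup>2 - y\<^sup>2 * u\<^sup>2"
    by (simp add: algebra_simps power2_eq_square)
  also have "\<dots> = q * (v\<^sup>2 - y\<^sup>2)"
    unfolding squares by (simp add: algebra_simps)
  finally have "(x * v - y * u) * (x * v + y * u) = q * (v\<^sup>2 - y\<^sup>2)" .
  then have "q dvd (x * v - y * u) * (x * v + y * u)" by simp
  then have "q dvd x * v - y * u \<or> q dvd x * v + y * u"
    using assms(1) prime_dvd_mult_iff by blast
  then obtain w where w: "q dvd w" "w = x * v - y * u \<or> w = x * v + y * u" by blast
  define w' where "w' = (if w = x * v - y * u then x * u + y * v else x * u - y * v)"
  have "w\<^sup>2 + w'\<^sup>2 = (x\<^sup>2 + y\<^sup>2) * (u\<^sup>2 + v\<^sup>2)"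
  proof (cases "w = x * v - y * u")
    case True
    then have "w' = x * u + y * v" by (simp add: w'_def)
    then show ?thesis unfolding True by (simp add: power2_eq_square algebra_simps)
  next
    case False
    then have *: "w = x * v + y * u" "w' = x * u - y * v" using w(2) by (simp_all add: w'_def)
    show ?thesis unfolding * by (simp add: power2_eq_square algebra_simps)
  qed
  then have norm: "w\<^sup>2 + w'\<^sup>2 = q\<^sup>2"
    unfolding assms(2,3) by (simp add: power2_eq_square)
  \<comment> \<open>Parity excludes w' = 0, the case in which the roles of the two squares would be
    swapped.\<close>
  have "odd w'" using assms evens unfolding w'_def by auto
  then have "w' \<noteq> 0" by auto
  then have "w\<^sup>2 < q\<^sup>2" using norm zero_less_power2[of w'] by linarith
  then have "\<bar>w\<bar> < \<bar>q\<bar>" using abs_le_square_iff[of q w] by linarith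
  then have "w = 0" using w(1) by (metis abs_of_nonneg dvd_imp_le_int not_less abs_ge_zero abs_abs)
  then have "x * v = y * u \<or> x * v = - (y * u)" using w(2) by auto
  then have "x\<^sup>2 * v\<^sup>2 = y\<^sup>2 * u\<^sup>2"
    by (metis power2_minus power_mult_distrib)
  then have "q * v\<^sup>2 = q * y\<^sup>2"
    unfolding squares by (simp add: algebra_simps)
  then show ?thesis using assms(1) by auto
qed

section \<open>Autocorrelation of the sequence \<open>f\<close>\<close>

context prime_primroot
begin

lemma g_residues: "bij_betw (\<lambda>a. int g ^ a mod int p) {..<4 * N} {1..int p - 1}"
proof -
  have "bij_betw (\<lambda>i. g ^ i mod p) {..<4 * N} (totatives p)"
    using residue_primroot_is_generator[of p g] primroot prime p_gt_2 p_eq by (simp add: totient_prime)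
  also have "totatives p = {0<..<p}"
    using totatives_prime[OF prime] .
  finally have 1: "bij_betw (\<lambda>i. g ^ i mod p) {..<4 * N} {0<..<p}" .
  have 2: "bij_betw int {0<..<p} {1..int p - 1}"
    by (rule bij_betwI[where g = nat]) auto
  show ?thesis
    using bij_betw_trans[OF 1 2] by (simp add: comp_def of_nat_mod)
qed

lemma sum_residues:
  "(\<Sum>a<4 * N. h (int g ^ a mod int p)) = (\<Sum>x\<in>{1..int p - 1}. h x)"
  using sum.reindex_bij_betw[OF g_residues] .

lemma Legendre_mod: "L (x mod int p) = L x"
  by (rule Legendre_cong) simp

lemma Legendre_0: "L 0 = 0"
  by (simp add: Legendre_eq_0_iff)

lemma sum_Legendre: "(\<Sum>x\<in>{0..int p - 1}. L x) = 0"
proof -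
  have "{0..int p - 1} = insert 0 {1..int p - 1}" using p_gt_2 by auto
  then have "(\<Sum>x\<in>{0..int p - 1}. L x) = (\<Sum>x\<in>{1..int p - 1}. L x)"
    by (simp add: Legendre_0)
  also have "\<dots> = (\<Sum>a<4 * N. (-1) ^ a)"
    unfolding sum_residues[symmetric] by (simp add: Legendre_mod Legendre_power Legendre_g)
  also have "\<dots> = 0"
  proof -
    have "(\<Sum>a<2 * n. (-1) ^ a) = (0 :: int)" for n by (induction n) auto
    from this[of "2 * N"] show ?thesis by simp
  qed
  finally show ?thesis .
qed

lemma inverse_residue:
  assumes "\<not> int p dvd z"
  shows "[z * z ^ (4 * N - 1) = 1] (mod int p)"
proof -
  have "[z ^ (4 * N) = 1] (mod int p)"
    using cong_pow[OF euler[of z], of 2] Legendre_square[OF assms]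
    by (simp add: power2_eq_square cong_sym flip: power_add)
  then show ?thesis using N_pos by (simp flip: power_Suc)
qed

text \<open>The substitution \<open>u = (1 - c * x) / (1 - x)\<close> turns the sum into the sum of \<open>\<phi> u\<close> over \<open>u \<noteq> c\<close>.\<close>
lemma sum_Legendre_quadratic:
  assumes c: "\<not> int p dvd c - 1"
  shows "(\<Sum>x\<in>{1..int p - 1}. L ((1 - c * x) * (1 - x))) = - 1 - L c"
proof -
  let ?U = "{0..int p - 1}"
  let ?h = "\<lambda>x. L ((1 - c * x) * (1 - x))"
  \<comment> \<open>The power \<open>4 * N - 1\<close> inverts 1 - x by Fermat.\<close>
  define u where "u x = ((1 - c * x) * (1 - x) ^ (4 * N - 1)) mod int p" for x
  have nd: "\<not> int p dvd 1 - x" if "x \<in> ?U - {1}" for x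
  proof
    assume "int p dvd 1 - x"
    then have "[1 = x] (mod int p)" by (simp add: cong_iff_dvd_diff)
    then have "1 = x" using that p_gt_2 by (intro cong_less_imp_eq_int[of 1 "int p" x]) auto
    with that show False by simp
  qed
  have u: "[u x * (1 - x) = 1 - c * x] (mod int p)" if "x \<in> ?U - {1}" for x
  proof -
    have "[u x * (1 - x) = ((1 - c * x) * (1 - x) ^ (4 * N - 1)) * (1 - x)] (mod int p)"
      unfolding u_def by (intro cong_scalar_right) simp
    moreover have "[(1 - c * x) * ((1 - x) * (1 - x) ^ (4 * N - 1)) = (1 - c * x) * 1] (mod int p)"
      by (intro cong_scalar_left inverse_residue nd that)
    ultimately show ?thesis by (simp add: mult_ac) (metis cong_trans)
  qed
  have inj: "inj_on u (?U - {1})"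
  proof (rule inj_onI)
    fix x y assume xy: "x \<in> ?U - {1}" "y \<in> ?U - {1}" "u x = u y"
    have "[(1 - c * x) * (1 - y) = u x * (1 - x) * (1 - y)] (mod int p)"
      by (intro cong_scalar_right cong_sym[OF u] xy)
    moreover have "u x * (1 - x) * (1 - y) = u y * (1 - y) * (1 - x)"
      by (simp add: xy(3))
    moreover have "[u y * (1 - y) * (1 - x) = (1 - c * y) * (1 - x)] (mod int p)"
      by (intro cong_scalar_right u xy)
    ultimately have "[(1 - c * x) * (1 - y) = (1 - c * y) * (1 - x)] (mod int p)"
      by (metis cong_trans)
    then have "int p dvd (y - x) * (c - 1)"
      by (simp add: cong_iff_dvd_diff algebra_simps)
    then have "int p dvd y - x" using dvd_mult_cases c by blast
    then have "[y = x] (mod int p)" by (simp add: cong_iff_dvd_diff)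
    then show "x = y" using xy(1,2) by (intro cong_less_imp_eq_int[of x "int p" y]) (auto simp: cong_sym)
  qed
  \<comment> \<open>The value c is missed, as u x = c would force c = 1; injectivity and equal
    cardinalities give the rest.\<close>
  have "u ` (?U - {1}) = ?U - {c mod int p}"
  proof (rule card_subset_eq)
    show "u ` (?U - {1}) \<subseteq> ?U - {c mod int p}"
    proof safe
      fix x assume x: "x \<in> ?U" "x \<noteq> 1"
      show "u x \<in> ?U" using p_gt_2 by (simp add: u_def)
      assume "u x = c mod int p"
      then have "[u x = c] (mod int p)" by simp
      then have "[u x * (1 - x) = c * (1 - x)] (mod int p)" by (rule cong_scalar_right)
      then have "[1 - c * x = c * (1 - x)] (mod int p)"
        using u[of x] x by (metis DiffI cong_sym cong_trans singletonD)
      then have "int p dvd - (c - 1)" by (simp add: cong_iff_dvd_diff algebra_simps)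
      with c show False by (simp only: dvd_minus_iff)
    qed
    have "1 \<in> ?U" "c mod int p \<in> ?U" using p_gt_2 by auto
    then show "card (u ` (?U - {1})) = card (?U - {c mod int p})"
      by (simp only: card_image[OF inj] card_Diff_singleton)
  qed simp
  then have "(\<Sum>y\<in>?U - {c mod int p}. L y) = (\<Sum>x\<in>?U - {1}. L (u x))"
    using sum.reindex[OF inj, of L] by simp
  also have "\<dots> = (\<Sum>x\<in>?U - {1}. ?h x)"
  proof (rule sum.cong)
    fix x assume x: "x \<in> ?U - {1}"
    have "L (1 - c * x) = L (u x) * L (1 - x)"
      using Legendre_cong[OF u[OF x]] by (simp add: Legendre_mult)
    then show "L (u x) = ?h x"
      using Legendre_square[OF nd[OF x]] by (simp add: Legendre_mult)
  qed simp
  also have "\<dots> = (\<Sum>x\<in>?U. ?h x)"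
    using p_gt_2 by (subst sum.remove[of ?U 1]) (auto simp: Legendre_0)
  also have "\<dots> = 1 + (\<Sum>x\<in>{1..int p - 1}. ?h x)"
  proof -
    have "?U = insert 0 {1..int p - 1}" using p_gt_2 by auto
    then show ?thesis by (simp add: Legendre_1)
  qed
  finally have "(\<Sum>x\<in>{1..int p - 1}. ?h x) = (\<Sum>y\<in>?U - {c mod int p}. L y) - 1" by simp
  moreover have "(\<Sum>y\<in>?U. L y) = L c + (\<Sum>y\<in>?U - {c mod int p}. L y)"
    using p_gt_2 by (subst sum.remove[of ?U "c mod int p"]) (auto simp: Legendre_mod)
  ultimately show ?thesis using sum_Legendre by simp
qed

text \<open>Putting x = g^b turns the autocorrelation into the quadratic character sum with c =
  g^t.\<close>

lemma f_correlation:
  assumes "\<not> 4 * N dvd t"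
  shows "(\<Sum>b<4 * N. f (b + t) * f b) = - 1 - (-1) ^ t"
proof -
  have "f (b + t) * f b = L ((1 - int g ^ t * (int g ^ b mod int p)) * (1 - int g ^ b mod int p))" for b
    unfolding f_def Legendre_mult[symmetric]
    by (intro Legendre_cong cong_mult cong_diff)
      (auto simp: power_add mult.commute cong_def mod_mult_right_eq)
  then have "(\<Sum>b<4 * N. f (b + t) * f b) = (\<Sum>x\<in>{1..int p - 1}. L ((1 - int g ^ t * x) * (1 - x)))"
    by (simp only: sum_residues[of "\<lambda>x. L ((1 - int g ^ t * x) * (1 - x))"])
  also have "\<dots> = - 1 - L (int g ^ t)"
    using assms g_power_eq_1_iff[of t] by (intro sum_Legendre_quadratic) (simp add: cong_iff_dvd_diff)
  finally show ?thesis by (simp add: Legendre_power Legendre_g)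
qed

lemma f_square_sum: "(\<Sum>b<4 * N. f b * f b) = 4 * int N - 1"
proof -
  have "(\<Sum>b<4 * N. f b * f b) = f 0 * f 0 + (\<Sum>b\<in>{..<4 * N} - {0}. f b * f b)"
    using N_pos by (subst sum.remove[of _ 0]) auto
  also have "(\<Sum>b\<in>{..<4 * N} - {0}. f b * f b) = (\<Sum>b\<in>{..<4 * N} - {0}. 1)"
    by (intro sum.cong f_odd) (auto dest!: dvd_imp_le)
  finally show ?thesis using N_pos by (simp add: f_0 card_Diff_singleton of_nat_diff)
qed

end

locale prime_root = prime_primroot +
  fixes \<xi> :: complex
  assumes root_iff: "\<xi> ^ k = 1 \<longleftrightarrow> 4 * N dvd k"
begin

lemma root_nonzero: "\<xi> \<noteq> 0"
  using root_iff[of "4 * N"] N_pos by (cases "\<xi> = 0") (auto simp: power_0_left)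

lemma root_half: "\<xi> ^ (2 * N) = -1"
proof -
  have "(\<xi> ^ (2 * N)) ^ 2 = 1" by (simp add: root_iff flip: power_mult)
  moreover have "\<xi> ^ (2 * N) \<noteq> 1"
    using N_pos by (auto simp: root_iff dest: dvd_imp_le)
  ultimately show ?thesis using power2_eq_1_iff by blast
qed

lemma root_norm: "norm \<xi> = 1"
  using power_eq_imp_eq_norm[of \<xi> "4 * N" 1] root_iff[of "4 * N"] N_pos by simp

lemma root_mod_complex: "root_mod 0 \<xi> (1 / \<xi>) N"
proof
  show "\<not> [\<xi> ^ (2 * t) = 1] (mod 0)" if "0 < t" "t < 2 * N" for t
    using that by (auto simp: root_iff dest: dvd_imp_le)
qed (use N_pos root_nonzero root_half in auto)

sublocale R: root_mod 0 \<xi> "1 / \<xi>" N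
  by (rule root_mod_complex)

definition S :: "nat \<Rightarrow> complex" where "S = R.sine_sum (\<lambda>j. f (2 * j + 1))"

definition D :: int where
  "D = det (mat (N - 1) (N - 1) (\<lambda>(j, l).
     \<Sum>i<N - 1. ((f (2 * i + 1) + f (2 * Suc i + 1)) div 2) * cheb (N - 1) i j l))"

lemma Legendre_D: "L D = 1"
  unfolding D_def by (rule Legendre_det_chebyshev)

text \<open>Modulo 0 the congruence \<open>prod_sine_sum\<close> is an equality of complex numbers,
  with the same integer determinant whose Legendre symbol was computed modulo
  \<open>p\<close>.\<close>

lemma prod_S: "(\<Prod>k = 1..<N. S k) = 2 ^ (N - 1) * (\<Prod>k = 1..<N. R.sn k) * of_int D"
proof -
  have "odd (f (2 * j + 1))" if "j < N" for j
    using that by (intro f_odd) (auto dest!: dvd_imp_le)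
  from R.prod_sine_sum[of "\<lambda>j. f (2 * j + 1)", OF this] show ?thesis
    by (simp only: cong_0 S_def D_def)
qed

lemma prod_sn_squared: "(\<Prod>k = 1..<N. R.sn k) ^ 2 = (-1) ^ (N - 1) * of_nat N"
  using R.prod_sn_squared by (simp only: cong_0)

lemma sum_full_period: "(\<Sum>a<4 * N. of_int (f a) * R.sn (a * k)) = 2 * S k"
  using R.sum_full_period[of f k] f_0 f_refl by (simp only: cong_0 S_def less_imp_le)

text \<open>On odd exponents \<open>f\<close> is antisymmetric under a -> 4N - a, so half of them
  with \<xi>^a - \<xi>^(-a) amount to all of them with \<xi>^a alone.\<close>

lemma S_fold: "(\<Sum>t<2 * N. of_int (f (2 * t + 1)) * \<xi> ^ ((2 * t + 1) * k)) = S k"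
proof -
  let ?h = "\<lambda>t. of_int (f (2 * t + 1)) * \<xi> ^ ((2 * t + 1) * k)"
  have "(\<Sum>t<2 * N. ?h t) = (\<Sum>t<N. ?h t) + (\<Sum>t = N..<2 * N. ?h t)"
    using sum.atLeastLessThan_concat[of 0 N "2 * N" ?h] by (simp add: atLeast0LessThan)
  also have "(\<Sum>t = N..<2 * N. ?h t) = (\<Sum>j<N. ?h (2 * N - 1 - j))"
    by (rule sum.reindex_bij_witness[where i = "\<lambda>j. 2 * N - 1 - j" and j = "\<lambda>j. 2 * N - 1 - j"]) auto
  also have "\<dots> = (\<Sum>j<N. - (of_int (f (2 * j + 1)) * (1 / \<xi>) ^ ((2 * j + 1) * k)))"
  proof (intro sum.cong refl)
    fix j assume "j \<in> {..<N}"
    then have j: "2 * (2 * N - 1 - j) + 1 = 4 * N - (2 * j + 1)" "2 * j + 1 \<le> 4 * N" by auto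
    have "f (4 * N - (2 * j + 1)) = - f (2 * j + 1)"
      using f_refl[OF j(2)] by simp
    moreover have "\<xi> ^ ((4 * N - (2 * j + 1)) * k) = (1 / \<xi>) ^ ((2 * j + 1) * k)"
      using R.full_period_diff(1)[OF j(2), of k] by (simp only: cong_0)
    ultimately show "?h (2 * N - 1 - j) = - (of_int (f (2 * j + 1)) * (1 / \<xi>) ^ ((2 * j + 1) * k))"
      unfolding j(1) by simp
  qed
  finally show ?thesis
    by (simp only: S_def R.sine_sum_def right_diff_distrib sum_subtractf sum_negf) simp
qed

text \<open>An odd multiple of 2N in the exponent gives -1, so k -> 2N - k exchanges the two terms
  of each sine and their signs.\<close>

lemma S_reflect:
  assumes "k \<le> 2 * N"
  shows "S (2 * N - k) = S k"
  unfolding S_def R.sine_sum_def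
proof (intro sum.cong refl arg_cong[where f = "(*) _"])
  fix j
  have eq: "(2 * j + 1) * (2 * N - k) + (2 * j + 1) * k = 2 * N * (2 * j + 1)"
    using assms by (simp only: distrib_left[symmetric]) simp
  have "\<xi> ^ ((2 * j + 1) * (2 * N - k)) * \<xi> ^ ((2 * j + 1) * k) = -1"
    unfolding power_add[symmetric] eq power_mult[of _ "2 * N"] root_half by simp
  then have "\<xi> ^ ((2 * j + 1) * (2 * N - k)) = - ((1 / \<xi>) ^ ((2 * j + 1) * k))"
    using root_nonzero by (simp add: field_simps power_divide)
  then show "R.sn ((2 * j + 1) * (2 * N - k)) = R.sn ((2 * j + 1) * k)"
    using root_nonzero by (simp add: power_divide)
qed

text \<open>By \<open>S_reflect\<close> the factors pair up as k and 2N - k, leaving k = N alone.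
  The squared half product is evaluated by \<open>prod_S\<close> and
  \<open>prod_sn_squared\<close>.\<close>

lemma prod_norm_S: "(\<Prod>k = 1..<2 * N. norm (S k)) = norm (S N) * (4 ^ (N - 1) * real N * (of_int D)\<^sup>2)"
proof -
  let ?h = "\<lambda>k. norm (S k)"
  have "{1..<2*N} = {1..<N} \<union> ({N} \<union> {N + 1..<2*N})" using N_pos by auto
  then have "prod ?h {1..<2*N} = prod ?h ({1..<N} \<union> ({N} \<union> {N + 1..<2*N}))" by (rule arg_cong)
  also have "\<dots> = prod ?h {1..<N} * prod ?h ({N} \<union> {N + 1..<2*N})"
    by (rule prod.union_disjoint) auto
  also have "prod ?h ({N} \<union> {N + 1..<2*N}) = ?h N * prod ?h {N + 1..<2*N}"
    by (subst prod.union_disjoint) auto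
  also have "prod ?h {N + 1..<2*N} = (\<Prod>k = 1..<N. ?h (2 * N - k))"
    by (rule prod.reindex_bij_witness[where i = "\<lambda>k. 2 * N - k" and j = "\<lambda>k. 2 * N - k"]) auto
  also have "\<dots> = prod ?h {1..<N}"
    by (intro prod.cong refl) (simp add: S_reflect)
  finally have 1: "prod ?h {1..<2*N} = ?h N * (prod ?h {1..<N})\<^sup>2"
    by (simp add: power2_eq_square mult_ac)
  have "prod ?h {1..<N} = 2 ^ (N - 1) * norm (\<Prod>k = 1..<N. R.sn k) * \<bar>of_int D\<bar>"
    unfolding prod_norm[of S] prod_S by (simp only: norm_mult norm_power norm_of_int norm_numeral)
  moreover have "(norm (\<Prod>k = 1..<N. R.sn k))\<^sup>2 = real N"
    unfolding norm_power[symmetric] prod_sn_squared by (simp add: norm_mult norm_power)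
  moreover have "(2 ^ (N - 1))\<^sup>2 = (4 :: real) ^ (N - 1)"
    by (simp add: power_mult[symmetric] mult.commute[of _ 2]) (simp add: power_mult)
  ultimately have "(prod ?h {1..<N})\<^sup>2 = 4 ^ (N - 1) * real N * (of_int D)\<^sup>2"
    by (simp add: power_mult_distrib)
  then show ?thesis unfolding 1 by simp
qed

section \<open>The quartic Jacobi sum and its norm\<close>

definition E :: int where "E = (\<Sum>j<N. f (2 * j + 1) * (-1) ^ j)"
definition C :: int where "C = (\<Sum>j<2 * N. f (2 * j) * (-1) ^ j)"

abbreviation \<iota> :: complex where "\<iota> \<equiv> \<xi> ^ N"

lemma iota_square: "\<iota> * \<iota> = -1"
  using root_half by (simp add: mult_2 power_add)

lemma iota_inverse: "1 / \<iota> = - \<iota>"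
  using iota_square root_nonzero by (simp add: field_simps)

lemma iota_odd_power: "\<iota> ^ (2 * j + 1) = \<iota> * (-1) ^ j"
  by (simp add: power_mult power2_eq_square iota_square)

lemma root_odd_power: "\<xi> ^ ((2 * j + 1) * N) = \<iota> * (-1) ^ j"
  using iota_odd_power[of j] by (simp only: power_mult mult.commute[of _ N])

lemma S_N: "S N = 2 * \<iota> * of_int E"
proof -
  have "R.sn ((2 * j + 1) * N) = 2 * \<iota> * (-1) ^ j" for j
  proof -
    have "(1 / \<xi>) ^ ((2 * j + 1) * N) = (- \<iota>) ^ (2 * j + 1)"
      by (simp only: power_mult mult.commute[of _ N] power_one_over iota_inverse)
    moreover have "(- \<iota>) ^ (2 * j + 1) = - (\<iota> * (-1) ^ j)"
      using iota_odd_power[of j] by simp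
    ultimately show ?thesis unfolding root_odd_power by simp
  qed
  then show ?thesis
    unfolding S_def R.sine_sum_def E_def by (simp add: sum_distrib_left mult_ac)
qed

lemma norm_S_N: "norm (S N) = 2 * real_of_int \<bar>E\<bar>"
  by (simp add: S_N norm_mult norm_power root_norm)

text \<open>The sum of \<open>f a * \<iota> ^ a\<close> is the quartic Jacobi sum. Its even
  exponents give \<open>C\<close> and its odd ones 2E times \<iota>, the factor 2 coming from
  \<open>S_fold\<close>. Its product with the sum for -\<iota> is computed from the autocorrelation
  of \<open>f\<close> and equals \<open>p\<close>.\<close>

lemma norm_identity: "C\<^sup>2 + (2 * E)\<^sup>2 = int p"
proof -
  let ?J = "\<Sum>a<4 * N. of_int (f a) * \<iota> ^ a"
  let ?J' = "\<Sum>a<4 * N. of_int (f a) * (- \<iota>) ^ a"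
  have "\<iota> * (\<Sum>j<2 * N. of_int (f (2 * j + 1)) * (-1) ^ j) = \<iota> * of_int (2 * E)"
    using S_fold[of N] unfolding root_odd_power S_N by (simp add: sum_distrib_left mult_ac)
  then have odd_part: "(\<Sum>j<2 * N. of_int (f (2 * j + 1)) * (-1) ^ j) = (of_int (2 * E) :: complex)"
    using root_nonzero by (simp only: mult_cancel_left) simp
  have parts: "(\<Sum>a<4 * N. of_int (f a) * x ^ a) = of_int C + x * of_int (2 * E)"
    if x: "x * x = -1" for x :: complex
  proof -
    have xe: "x ^ (2 * j) = (-1) ^ j" for j by (simp add: power_mult power2_eq_square x)
    have "(\<Sum>a<2*n. h a) = (\<Sum>j<n. h (2 * j)) + (\<Sum>j<n. h (2 * j + 1))" for n and h :: "nat \<Rightarrow> complex"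
      by (induction n) (auto simp: algebra_simps)
    from this[of _ "2 * N"]
    have "(\<Sum>a<4 * N. of_int (f a) * x ^ a) =
        (\<Sum>j<2 * N. of_int (f (2 * j)) * x ^ (2 * j)) + (\<Sum>j<2 * N. of_int (f (2 * j + 1)) * x ^ (2 * j + 1))"
      by simp
    also have "(\<Sum>j<2 * N. of_int (f (2 * j)) * x ^ (2 * j)) = of_int C"
      unfolding C_def xe by simp
    also have "(\<Sum>j<2 * N. of_int (f (2 * j + 1)) * x ^ (2 * j + 1)) =
        x * (\<Sum>j<2 * N. of_int (f (2 * j + 1)) * (-1) ^ j)"
      unfolding xe power_add power_one_right sum_distrib_left
      by (intro sum.cong refl) (simp only: mult_ac)
    also note odd_part
    finally show ?thesis .
  qed
  have i4: "\<iota> ^ (4 * N) = 1" "(- \<iota>) ^ (4 * N) = 1" and m: "- \<iota> * \<iota> = 1" "- \<iota> * - \<iota> = -1"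
    using iota_square by (auto simp: root_iff simp flip: power_mult)
  have "?J * ?J' = (\<Sum>b<4 * N. \<Sum>a<4 * N. of_int (f a) * of_int (f b) * \<iota> ^ a * (- \<iota>) ^ b)"
    by (subst sum.swap) (simp add: sum_product mult_ac)
  \<comment> \<open>The substitution a = t + b is a cyclic shift of the inner sum, whose terms have
    period 4N.\<close>
  also have "\<dots> = (\<Sum>b<4 * N. \<Sum>t<4 * N. of_int (f (t + b)) * of_int (f b) * \<iota> ^ (t + b) * (- \<iota>) ^ b)"
  proof (rule sum.cong[OF refl], rule sum_periodic_shift[symmetric])
    fix b t
    have "f (t + 4 * N) = f t" by (rule f_cong) (simp add: cong_def)
    then show "of_int (f (t + 4 * N)) * of_int (f b) * \<iota> ^ (t + 4 * N) * (- \<iota>) ^ b =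
        of_int (f t) * of_int (f b) * \<iota> ^ t * (- \<iota>) ^ b"
      by (simp add: power_add[of \<iota> t] i4)
  qed
  also have "\<dots> = (\<Sum>t<4 * N. \<iota> ^ t * of_int (\<Sum>b<4 * N. f (b + t) * f b))"
  proof -
    have key: "\<iota> ^ (t + b) * (- \<iota>) ^ b = \<iota> ^ t" for t b
      using m(1) by (simp only: power_add mult.assoc power_mult_distrib[symmetric] mult.commute[of \<iota>]) simp
    show ?thesis
      by (subst sum.swap, unfold of_int_sum of_int_mult sum_distrib_left mult.assoc key, intro sum.cong refl)
        (simp only: mult_ac add.commute)
  qed
  \<comment> \<open>At t = 0 the correlation is p - 2, which is the general value -1 - (-1)^t
    increased by p.\<close>
  also have "\<dots> = (\<Sum>t<4 * N. (if t = 0 then of_nat p else 0) - \<iota> ^ t - (- \<iota>) ^ t)"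
  proof (rule sum.cong[OF refl])
    fix t assume "t \<in> {..<4 * N}"
    then have t: "\<not> 4 * N dvd t" if "t \<noteq> 0" using that by (auto dest: dvd_imp_le)
    show "\<iota> ^ t * of_int (\<Sum>b<4 * N. f (b + t) * f b) = (if t = 0 then of_nat p else 0) - \<iota> ^ t - (- \<iota>) ^ t"
    proof (cases "t = 0")
      case True
      then show ?thesis using f_square_sum by (simp add: p_eq)
    next
      case False
      then show ?thesis
        unfolding f_correlation[OF t[OF False]]
        by (simp add: algebra_simps power_minus[of \<iota>])
    qed
  qed
  also have "\<dots> = of_nat p - (\<Sum>t<4 * N. \<iota> ^ t) - (\<Sum>t<4 * N. (- \<iota>) ^ t)"
    using N_pos by (simp only: sum_subtractf) (simp add: sum.delta)
  also have "(\<Sum>t<4 * N. x ^ t) = 0" if "x * x = -1" "x ^ (4 * N) = 1" for x :: complex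
  proof -
    have "x \<noteq> 1" using that(1) by auto
    then show ?thesis using that(2) by (simp add: sum_gp_strict)
  qed
  note * = this
  have "(\<Sum>t<4 * N. \<iota> ^ t) = 0" "(\<Sum>t<4 * N. (- \<iota>) ^ t) = 0"
    using *[of \<iota>] *[of "- \<iota>"] iota_square i4 m by auto
  ultimately have "?J * ?J' = of_nat p" by simp
  moreover have "?J * ?J' = of_int (C\<^sup>2 + (2 * E)\<^sup>2)"
  proof -
    have "(x + i * y) * (x + - i * y) = x * x - (i * i) * (y * y)" for x y i :: complex
      by (simp add: algebra_simps)
    then show ?thesis
      unfolding parts[OF iota_square] parts[OF m(2)] by (simp add: iota_square power2_eq_square)
  qed
  ultimately have "of_int (C\<^sup>2 + (2 * E)\<^sup>2) = (of_int (int p) :: complex)" by simp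
  then show ?thesis by (simp only: of_int_eq_iff)
qed

text \<open>Both C^2 + (2E)^2 and c^2 + (2b)^2 represent \<open>p\<close> with an odd first term, so
  the even terms agree up to sign.\<close>

lemma E_eq:
  assumes "p = c\<^sup>2 + 4 * b\<^sup>2"
  shows "\<bar>E\<bar> = int b"
proof -
  have "odd (int p)" using p_eq by simp
  then have "odd C" using norm_identity by (metis even_add even_mult_iff even_numeral power2_eq_square)
  moreover have c: "(int c)\<^sup>2 + (2 * int b)\<^sup>2 = int p" using assms by (simp add: power_mult_distrib)
  moreover have "odd (int c)" using c \<open>odd (int p)\<close> by (metis even_add even_mult_iff even_numeral power2_eq_square)
  ultimately have "(2 * E)\<^sup>2 = (2 * int b)\<^sup>2"
    using sum_squares_unique[OF prime_int norm_identity c] \<open>odd (int p)\<close> by blast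
  then show ?thesis by (auto simp: power2_eq_iff)
qed

end

subsection \<open>The determinant of the bordered group matrix\<close>

context prime_root
begin

text \<open>Orthogonality of the characters of the group of squares, which is cyclic of order
  2N.\<close>

lemma sum_root_powers:
  assumes "k < 2 * N" "l < 2 * N"
  shows "(\<Sum>a<2 * N. (1 / \<xi>) ^ (2 * a * k) * \<xi> ^ (2 * a * l)) = (if k = l then of_nat (2 * N) else 0)"
proof -
  have powers: "(1 / \<xi>) ^ (2 * a * k) * \<xi> ^ (2 * a * l) = (\<xi> ^ (2 * l) / \<xi> ^ (2 * k)) ^ a" for a
    by (simp add: power_divide power_mult[symmetric] mult_ac)
  show ?thesis
  proof (cases "k = l")
    case True
    then show ?thesis unfolding powers using root_nonzero by simp
  next
    case False
    let ?y = "\<xi> ^ (2 * l) / \<xi> ^ (2 * k)"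
    have cancel: "i = j" if "\<xi> ^ (2 * i) = \<xi> ^ (2 * j)" "i \<le> j" "j < 2 * N" for i j
    proof -
      have "\<xi> ^ (2 * j) = \<xi> ^ (2 * i) * \<xi> ^ (2 * (j - i))"
        using that(2) by (simp add: power_add[symmetric] right_diff_distrib')
      then have "\<xi> ^ (2 * (j - i)) = 1"
        using that(1) root_nonzero by simp
      then have "4 * N dvd 2 * (j - i)" by (simp only: root_iff)
      then show ?thesis using that by (auto dest!: dvd_imp_le)
    qed
    have "?y \<noteq> 1"
      using cancel[of k l] cancel[of l k] False assms root_nonzero by (cases "k \<le> l") auto
    moreover have "?y ^ (2 * N) = 1"
    proof -
      have "(\<xi> ^ (2 * j)) ^ (2 * N) = 1" for j
        unfolding power_mult[symmetric] root_iff by simp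
      then show ?thesis by (simp only: power_divide div_by_1)
    qed
    ultimately have "(\<Sum>a<2 * N. ?y ^ a) = 0"
      by (simp only: sum_gp_strict if_False diff_self div_0)
    then show ?thesis
      unfolding powers using False by (simp only: if_False)
  qed
qed

definition eigenvalue :: "nat \<Rightarrow> nat \<Rightarrow> complex" where
  "eigenvalue q k = (\<Sum>t<2 * N. of_int (f (q + 2 * t)) * \<xi> ^ (2 * t * k))"

lemma f_periodic: "f (a + 4 * N) = f a"
  by (rule f_cong) (simp add: cong_def)

lemma root_periodic: "\<xi> ^ (a + 4 * N * k) = \<xi> ^ a"
  using root_iff[of "4 * N * k"] by (simp add: power_add)

text \<open>A character is an eigenvector of a group matrix. The summand
  \<open>4 * N - 2 * b\<close> represents -2b within the naturals.\<close>

lemma circulant_eigen: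
  assumes "b < 2 * N"
  shows "(\<Sum>a<2 * N. of_int (f (q + 2 * a + (4 * N - 2 * b))) * \<xi> ^ (2 * a * k)) =
    eigenvalue q k * \<xi> ^ (2 * b * k)"
proof -
  let ?h = "\<lambda>a. of_int (f (q + 2 * a + (4 * N - 2 * b))) * \<xi> ^ (2 * a * k)"
  have "?h (t + 2 * N) = ?h t" for t
  proof -
    have "q + 2 * (t + 2 * N) + (4 * N - 2 * b) = (q + 2 * t + (4 * N - 2 * b)) + 4 * N"
      "2 * (t + 2 * N) * k = 2 * t * k + 4 * N * k"
      by (simp_all add: algebra_simps)
    then show ?thesis by (simp only: f_periodic root_periodic)
  qed
  then have "(\<Sum>t<2 * N. ?h t) = (\<Sum>t<2 * N. ?h (t + b))"
    by (rule sum_periodic_shift[symmetric])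
  also have "\<dots> = (\<Sum>t<2 * N. of_int (f (q + 2 * t)) * \<xi> ^ (2 * t * k) * \<xi> ^ (2 * b * k))"
  proof (intro sum.cong refl)
    fix t
    have "q + 2 * (t + b) + (4 * N - 2 * b) = (q + 2 * t) + 4 * N"
      "2 * (t + b) * k = 2 * t * k + 2 * b * k"
      using assms by (simp_all add: algebra_simps)
    then show "?h (t + b) = of_int (f (q + 2 * t)) * \<xi> ^ (2 * t * k) * \<xi> ^ (2 * b * k)"
      by (simp only: f_periodic power_add mult.assoc)
  qed
  finally show ?thesis
    by (simp only: eigenvalue_def sum_distrib_right)
qed

text \<open>An odd shift \<open>q\<close> only permutes the terms of \<open>S k\<close> cyclically,
  up to the factor \<xi>^(qk) of modulus 1.\<close>

lemma norm_eigenvalue: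
  assumes "odd q"
  shows "norm (eigenvalue q k) = norm (S k)"
proof -
  obtain r where q: "q = 2 * r + 1" using assms by (elim oddE)
  let ?h = "\<lambda>t. of_int (f (2 * t + 1)) * \<xi> ^ ((2 * t + 1) * k)"
  have "?h (t + 2 * N) = ?h t" for t
  proof -
    have "2 * (t + 2 * N) + 1 = (2 * t + 1) + 4 * N"
      "(2 * (t + 2 * N) + 1) * k = (2 * t + 1) * k + 4 * N * k"
      by (simp_all add: algebra_simps)
    then show ?thesis by (simp only: f_periodic root_periodic)
  qed
  then have "S k = (\<Sum>t<2 * N. ?h (t + r))"
    unfolding S_fold[symmetric] by (rule sum_periodic_shift[symmetric])
  also have "\<dots> = (\<Sum>t<2 * N. \<xi> ^ (q * k) * (of_int (f (q + 2 * t)) * \<xi> ^ (2 * t * k)))"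
  proof (intro sum.cong refl)
    fix t
    have "2 * (t + r) + 1 = q + 2 * t" "(2 * (t + r) + 1) * k = q * k + 2 * t * k"
      by (simp_all add: q algebra_simps)
    then show "?h (t + r) = \<xi> ^ (q * k) * (of_int (f (q + 2 * t)) * \<xi> ^ (2 * t * k))"
      by (simp only: power_add mult.left_commute)
  qed
  also have "\<dots> = \<xi> ^ (q * k) * eigenvalue q k"
    by (simp only: eigenvalue_def sum_distrib_left)
  finally show ?thesis by (simp add: norm_mult norm_power root_norm)
qed

text \<open>The \<open>2 * N\<close> characters of the group of squares, extended by zero, together with the
  indicator of zero (column \<open>1\<close>), block-diagonalise the matrix; interchanging the first two
  columns turns the only nontrivial block into a triangular one.\<close>
lemma norm_det_bordered:
  fixes B :: "nat \<Rightarrow> nat" and T :: "nat \<Rightarrow> nat \<Rightarrow> int"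
  assumes B: "bij_betw B {..<2 * N} {..<2 * N}" and q: "odd q"
    and T: "T 0 0 = 0" "\<And>j. j < 2 * N \<Longrightarrow> T 0 (Suc j) = -1" "\<And>i. i < 2 * N \<Longrightarrow> T (Suc i) 0 = 1"
      "\<And>i j. i < 2 * N \<Longrightarrow> j < 2 * N \<Longrightarrow> T (Suc i) (Suc j) = f (q + 2 * B j + (4 * N - 2 * B i))"
  shows "\<bar>real_of_int (det (mat (2 * N + 1) (2 * N + 1) (\<lambda>(i, j). T i j)))\<bar> =
    real (2 * N) * (\<Prod>k = 1..<2 * N. norm (S k))"
proof -
  let ?n = "2 * N" and ?m = "Suc (2 * N)"
  let ?det = "\<lambda>X. det (mat ?m ?m (\<lambda>(i, j). X i j :: complex))"
  \<comment> \<open>Index 0 stands for the element zero, and index i > 0 for a square with half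
    logarithm \<open>B (i - 1)\<close>. Truncated subtraction makes column 0 the trivial character;
    column k > 1 carries the character k - 1. The conjugate table \<open>V\<close> serves to show
    that \<open>W\<close> is invertible.\<close>
  define W where "W i k = (if i = 0 then if k = 1 then 1 else 0 else
    if k = 1 then 0 else \<xi> ^ (2 * B (i - 1) * (k - 1)))" for i k :: nat
  define V where "V k i = (if i = 0 then if k = 1 then 1 else 0 else
    if k = 1 then 0 else (1 / \<xi>) ^ (2 * B (i - 1) * (k - 1)))" for i k :: nat
  define P :: "nat \<Rightarrow> nat \<Rightarrow> complex" where
    "P l k = (if l = Transposition.transpose 0 1 k then 1 else 0)" for l k
  define \<Lambda> where "\<Lambda> l k = (if l = k then if k = 0 then - of_nat ?n else if k = 1 then 1 else eigenvalue q (k - 1)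
    else if l = 1 \<and> k = 0 then eigenvalue q 0 else 0)" for l k :: nat
  have reindex: "(\<Sum>j<?n. h (B j)) = (\<Sum>a<?n. h a)" for h :: "nat \<Rightarrow> complex"
    using sum.reindex_bij_betw[OF B] .
  have B_less: "B i < ?n" if "i < ?n" for i
    using bij_betwE[OF B] that by auto
  have tr: "Transposition.transpose 0 1 k < ?m" if "k < ?m" for k :: nat
    using that N_pos by (auto simp: Transposition.transpose_def)
  have "(\<Sum>i<?m. V k i * W i l) = (if k = l then if k = 1 then 1 else of_nat ?n else 0)"
    if "k < ?m" "l < ?m" for k l
  proof -
    have "(\<Sum>i<?m. V k i * W i l) = V k 0 * W 0 l + (\<Sum>i<?n. V k (Suc i) * W (Suc i) l)"
      by (rule sum.lessThan_Suc_shift)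
    also have "(\<Sum>i<?n. V k (Suc i) * W (Suc i) l) = (if k = 1 \<or> l = 1 then 0 else
        (\<Sum>i<?n. (1 / \<xi>) ^ (2 * B i * (k - 1)) * \<xi> ^ (2 * B i * (l - 1))))"
      by (simp add: V_def W_def)
    also have "(\<Sum>i<?n. (1 / \<xi>) ^ (2 * B i * (k - 1)) * \<xi> ^ (2 * B i * (l - 1))) =
        (if k - 1 = l - 1 then of_nat ?n else 0)"
      unfolding reindex[of "\<lambda>a. (1 / \<xi>) ^ (2 * a * (k - 1)) * \<xi> ^ (2 * a * (l - 1))"]
      using that N_pos by (intro sum_root_powers) auto
    finally show ?thesis by (auto simp: V_def W_def)
  qed
  then have "?det V * ?det W = ?det (\<lambda>k l. if k = l then if k = 1 then 1 else of_nat ?n else 0)"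
    unfolding det_mat_mult[symmetric] by (intro arg_cong[where f = det] eq_matI) auto
  also have "\<dots> = (\<Prod>k<?m. if k = 1 then 1 else of_nat ?n)"
    by (rule trans[OF det_mat_lower_triangular]) auto
  also have "\<dots> \<noteq> 0" using N_pos by (subst prod_zero_iff) auto
  finally have W_nonzero: "?det W \<noteq> 0" by auto
  have "(\<Sum>l<?m. P i l * P l k) = (if i = k then 1 else 0)" if "i < ?m" "k < ?m" for i k
  proof -
    have "(\<Sum>l<?m. P i l * P l k) = (\<Sum>l<?m. if l = Transposition.transpose 0 1 k then P i l else 0)"
      by (intro sum.cong) (auto simp: P_def)
    then show ?thesis using tr[OF that(2)] by (simp add: sum.delta P_def)
  qed
  then have "?det P * ?det P = ?det (\<lambda>k l. if k = l then 1 else 0)"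
    unfolding det_mat_mult[symmetric] by (intro arg_cong[where f = det] eq_matI) auto
  also have "\<dots> = 1"
    by (rule trans[OF det_mat_lower_triangular]) auto
  finally have "norm (?det P) * norm (?det P) = 1" by (metis norm_mult norm_one)
  then have norm_P: "norm (?det P) = 1"
    by (metis norm_ge_zero power2_eq_square real_sqrt_abs abs_of_nonneg real_sqrt_one)
  have WP: "(\<Sum>l<?m. W i l * P l k) = W i (Transposition.transpose 0 1 k)" if "k < ?m" for i k
  proof -
    have "(\<Sum>l<?m. W i l * P l k) = (\<Sum>l<?m. if l = Transposition.transpose 0 1 k then W i l else 0)"
      by (intro sum.cong) (auto simp: P_def)
    then show ?thesis using tr[OF that] by (simp add: sum.delta)
  qed
  have char_sum: "(\<Sum>j<?n. \<xi> ^ (2 * B j * k)) = (if k = 0 then of_nat ?n else 0)" if "k < ?n" for k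
    unfolding reindex[of "\<lambda>a. \<xi> ^ (2 * a * k)"] using sum_root_powers[of 0 k] that N_pos by simp
  \<comment> \<open>In matrix form T W = W P \<Lambda>. T sends the indicator of zero to the trivial
    character, and the trivial character to \<open>eigenvalue q 0\<close> times itself minus 2N
    times the indicator. The former coefficient falls below the diagonal of \<Lambda>.\<close>
  have main: "(\<Sum>j<?m. of_int (T i j) * W j k) = (\<Sum>l<?m. W i (Transposition.transpose 0 1 l) * \<Lambda> l k)"
    if i: "i < ?m" and k: "k < ?m" for i k
  proof -
    have l: "(\<Sum>j<?m. of_int (T i j) * W j k) =
        of_int (T i 0) * W 0 k + (\<Sum>j<?n. of_int (T i (Suc j)) * W (Suc j) k)"
      by (rule sum.lessThan_Suc_shift)
    have "(\<Sum>l<?m. W i (Transposition.transpose 0 1 l) * \<Lambda> l k) =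
        (\<Sum>l<?m. (if l = k then W i (Transposition.transpose 0 1 k) * \<Lambda> k k else 0) +
          (if l = 1 then if k = 0 then W i 0 * eigenvalue q 0 else 0 else 0))"
      by (intro sum.cong) (auto simp: \<Lambda>_def)
    also have "\<dots> = W i (Transposition.transpose 0 1 k) * \<Lambda> k k + (if k = 0 then W i 0 * eigenvalue q 0 else 0)"
      using k N_pos by (simp add: sum.distrib sum.delta del: sum.lessThan_Suc)
    finally have r: "(\<Sum>l<?m. W i (Transposition.transpose 0 1 l) * \<Lambda> l k) =
      W i (Transposition.transpose 0 1 k) * \<Lambda> k k + (if k = 0 then W i 0 * eigenvalue q 0 else 0)" .
    consider "k = 0" | "k = 1" | "k > 1" by linarith
    note cases = this
    show ?thesis
    proof (cases i)
      case 0
      have s: "(\<Sum>j<?n. of_int (T 0 (Suc j)) * W (Suc j) k) = (if k = 0 then - of_nat ?n else 0)"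
      proof (cases "k = 1")
        case False
        have "(\<Sum>j<?n. of_int (T 0 (Suc j)) * W (Suc j) k) = - (\<Sum>j<?n. \<xi> ^ (2 * B j * (k - 1)))"
          using False by (simp add: T W_def sum_negf)
        then show ?thesis using char_sum[of "k - 1"] k False N_pos by auto
      qed (simp add: W_def)
      show ?thesis unfolding 0 unfolding l[unfolded 0] r[unfolded 0] s using cases
        by cases (simp_all add: T W_def \<Lambda>_def Transposition.transpose_def)
    next
      case (Suc i')
      then have i': "i' < ?n" using i by simp
      have s: "(\<Sum>j<?n. of_int (T (Suc i') (Suc j)) * W (Suc j) k) =
        (if k = 1 then 0 else eigenvalue q (k - 1) * \<xi> ^ (2 * B i' * (k - 1)))"
      proof (cases "k = 1")
        case False
        have "(\<Sum>j<?n. of_int (T (Suc i') (Suc j)) * W (Suc j) k) =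
            (\<Sum>j<?n. of_int (f (q + 2 * B j + (4 * N - 2 * B i'))) * \<xi> ^ (2 * B j * (k - 1)))"
          using False i' by (simp add: T W_def)
        also have "\<dots> = eigenvalue q (k - 1) * \<xi> ^ (2 * B i' * (k - 1))"
          unfolding reindex[of "\<lambda>a. of_int (f (q + 2 * a + (4 * N - 2 * B i'))) * \<xi> ^ (2 * a * (k - 1))"]
          by (rule circulant_eigen[OF B_less[OF i']])
        finally show ?thesis using False by simp
      qed (simp add: W_def)
      show ?thesis unfolding Suc unfolding l[unfolded Suc] r[unfolded Suc] s using cases
        by cases (simp_all add: T i' W_def \<Lambda>_def Transposition.transpose_def)
    qed
  qed
  have "?det (\<lambda>i j. of_int (T i j)) * ?det W = ?det (\<lambda>i k. \<Sum>j<?m. of_int (T i j) * W j k)"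
    by (rule det_mat_mult[symmetric])
  also have "\<dots> = ?det (\<lambda>i k. \<Sum>l<?m. (\<Sum>j<?m. W i j * P j l) * \<Lambda> l k)"
  proof -
    have "(\<Sum>j<?m. of_int (T i j) * W j k) = (\<Sum>l<?m. (\<Sum>j<?m. W i j * P j l) * \<Lambda> l k)"
      if "i < ?m" "k < ?m" for i k
      unfolding main[OF that] by (intro sum.cong refl) (simp only: WP lessThan_iff)
    then show ?thesis
      by (intro arg_cong[where f = det] eq_matI)
        (simp_all only: dim_row_mat dim_col_mat index_mat case_prod_conv)
  qed
  also have "\<dots> = ?det W * ?det P * ?det \<Lambda>"
    by (simp only: det_mat_mult)
  finally have "?det (\<lambda>i j. of_int (T i j)) = ?det P * ?det \<Lambda>"
    using W_nonzero by simp
  then have "norm (?det (\<lambda>i j. of_int (T i j))) = norm (?det \<Lambda>)"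
    by (simp only: norm_mult norm_P mult_1_left)
  also have "?det \<Lambda> = (\<Prod>k<?m. \<Lambda> k k)"
    by (rule det_mat_lower_triangular) (auto simp: \<Lambda>_def)
  also have "norm (\<Prod>k<?m. \<Lambda> k k) = (\<Prod>k<?m. norm (\<Lambda> k k))"
    by (rule prod_norm[symmetric])
  also have "\<dots> = norm (\<Lambda> 0 0) * (norm (\<Lambda> 1 1) * (\<Prod>k = 1..<?n. norm (\<Lambda> (Suc k) (Suc k))))"
  proof -
    obtain r where r: "?n = Suc r" using N_pos by (cases ?n) auto
    have "(\<Prod>k<r. norm (\<Lambda> (Suc (Suc k)) (Suc (Suc k)))) = (\<Prod>k = 1..<?n. norm (\<Lambda> (Suc k) (Suc k)))"
      unfolding r by (rule prod.reindex_bij_witness[where i = "\<lambda>k. k - 1" and j = Suc]) auto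
    then show ?thesis unfolding r prod.lessThan_Suc_shift by simp
  qed
  also have "(\<Prod>k = 1..<?n. norm (\<Lambda> (Suc k) (Suc k))) = (\<Prod>k = 1..<?n. norm (S k))"
    by (intro prod.cong refl) (auto simp: \<Lambda>_def norm_eigenvalue[OF q])
  also have "norm (\<Lambda> 0 0) * (norm (\<Lambda> 1 1) * (\<Prod>k = 1..<?n. norm (S k))) = real ?n * (\<Prod>k = 1..<?n. norm (S k))"
    by (simp add: \<Lambda>_def norm_mult)
  also have "?det (\<lambda>i j. of_int (T i j)) = of_int (det (mat ?m ?m (\<lambda>(i, j). T i j)))"
    by (subst of_int_hom.hom_det[symmetric])
      (auto intro!: arg_cong[where f = det] eq_matI simp del: of_int_hom.hom_det)
  finally show ?thesis by simp
qed

end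

subsection \<open>Characters and Jacobi sums\<close>

context prime_primroot
begin

lemma carrier_Fp: "carrier (Fp p) = {0..int p - 1}"
  by (simp add: residue_ring_def)

lemma carrier_mult_of_Fp: "carrier (mult_of (Fp p)) = {1..int p - 1}"
  by (auto simp: residue_ring_def carrier_mult_of)

lemma mult_Fp: "x \<otimes>\<^bsub>Fp p\<^esub> y = x * y mod int p"
  by (simp add: residue_ring_def)

lemma add_Fp: "x \<oplus>\<^bsub>Fp p\<^esub> y = (x + y) mod int p"
  by (simp add: residue_ring_def)

lemma minus_Fp: "\<one>\<^bsub>Fp p\<^esub> \<ominus>\<^bsub>Fp p\<^esub> x = (1 - x) mod int p"
proof -
  interpret residues_prime p "Fp p" by unfold_locales (rule prime)
  show ?thesis
    by (simp add: a_minus_def res_neg_eq add_Fp res_one_eq mod_simps)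
qed

lemma carrier_char_group:
  "\<chi> \<in> carrier (char_group p) \<longleftrightarrow>
     (\<forall>x\<in>{1..int p - 1}. \<chi> x \<noteq> 0) \<and>
     (\<forall>x\<in>{1..int p - 1}. \<forall>y\<in>{1..int p - 1}. \<chi> (x * y mod int p) = \<chi> x * \<chi> y) \<and>
     (\<forall>x. x \<notin> {1..int p - 1} \<longrightarrow> \<chi> x = 0)"
  unfolding char_group_def hom_def Cx_def partial_object.simps monoid.simps
    carrier_mult_of_Fp mult_mult_of mult_Fp
  by auto

lemma mult_char_group: "\<chi> \<otimes>\<^bsub>char_group p\<^esub> \<psi> = (\<lambda>x. \<chi> x * \<psi> x)"
  by (simp add: char_group_def)

lemma one_char_group: "\<one>\<^bsub>char_group p\<^esub> = (\<lambda>x. if x \<in> {1..int p - 1} then 1 else 0)"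
  unfolding char_group_def monoid.simps carrier_mult_of_Fp ..

lemma mult_in_carrier:
  assumes "x \<in> {1..int p - 1}" "y \<in> {1..int p - 1}"
  shows "x * y mod int p \<in> {1..int p - 1}"
proof -
  have "\<not> int p dvd x" "\<not> int p dvd y" using assms by (auto dest: zdvd_imp_le)
  then have "\<not> int p dvd x * y" using dvd_mult_cases by blast
  then have "x * y mod int p \<noteq> 0" by (simp add: dvd_eq_mod_eq_0)
  moreover have "0 \<le> x * y mod int p" "x * y mod int p < int p" using p_gt_2 by auto
  ultimately show ?thesis by auto
qed

lemma residue_is_power:
  assumes "x \<in> {1..int p - 1}"
  obtains a where "a < 4 * N" "x = int g ^ a mod int p"
proof -
  have "x \<in> (\<lambda>a. int g ^ a mod int p) ` {..<4 * N}"
    using assms bij_betw_imp_surj_on[OF g_residues] by blast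
  then show ?thesis using that by blast
qed

lemma power_in_residues: "int g ^ a mod int p \<in> {1..int p - 1}"
proof -
  have "int g ^ a mod int p \<noteq> 0" using g_not_dvd[of a] by (simp add: dvd_eq_mod_eq_0)
  moreover have "0 \<le> int g ^ a mod int p" "int g ^ a mod int p < int p" using p_gt_2 by auto
  ultimately show ?thesis by auto
qed

lemma group_char_group: "group (char_group p)"
proof (rule groupI)
  fix x assume x: "x \<in> carrier (char_group p)"
  show "\<exists>y\<in>carrier (char_group p). y \<otimes>\<^bsub>char_group p\<^esub> x = \<one>\<^bsub>char_group p\<^esub>"
    by (rule bexI[of _ "\<lambda>a. inverse (x a)"]) (use x in \<open>auto simp: carrier_char_group mult_char_group one_char_group\<close>)
next
  show "\<one>\<^bsub>char_group p\<^esub> \<in> carrier (char_group p)"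
    unfolding carrier_char_group one_char_group using mult_in_carrier by simp
next
  fix x assume "x \<in> carrier (char_group p)"
  then show "\<one>\<^bsub>char_group p\<^esub> \<otimes>\<^bsub>char_group p\<^esub> x = x"
    by (intro ext) (auto simp: carrier_char_group mult_char_group one_char_group)
qed (auto simp: carrier_char_group mult_char_group mult_ac)

lemma char_nat_power:
  "(\<chi> [^]\<^bsub>char_group p\<^esub> (k :: nat)) x = (if x \<in> {1..int p - 1} then \<chi> x ^ k else 0)"
  if "\<chi> \<in> carrier (char_group p)"
  using that by (induction k) (auto simp: nat_pow_def carrier_char_group mult_char_group one_char_group)

lemma char_int_power:
  assumes "\<chi> \<in> carrier (char_group p)"
  shows "(\<chi> [^]\<^bsub>char_group p\<^esub> (k :: int)) x = (if x \<in> {1..int p - 1} then \<chi> x powi k else 0)"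
proof -
  interpret group "char_group p" by (rule group_char_group)
  have pow: "\<chi> [^]\<^bsub>char_group p\<^esub> (j :: nat) \<in> carrier (char_group p)" for j
    using assms by (rule nat_pow_closed)
  have inv: "inv\<^bsub>char_group p\<^esub> y = (\<lambda>a. inverse (y a))" if "y \<in> carrier (char_group p)" for y
    using that by (intro inv_equality) (auto simp: carrier_char_group mult_char_group one_char_group)
  show ?thesis
  proof (cases "k < 0")
    case True
    then have "\<not> 0 \<le> k" by simp
    then show ?thesis
      using True by (simp only: int_pow_def2 if_True if_False inv[OF pow] char_nat_power[OF assms]
          power_int_def power_inverse) simp
  next
    case False
    then have "0 \<le> k" by simp
    then show ?thesis
      using False by (simp only: int_pow_def2 if_True if_False char_nat_power[OF assms] power_int_def)
  qed
qed

text \<open>The substitution y = 1 - x moves the quadratic character to 1 - y; the nonzero y are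
  then powers of \<open>g\<close>.\<close>

lemma jacobi_sum_eq:
  assumes "\<psi> 0 = 0"
  shows "jacobi_sum p (\<lambda>x. of_int (quad_char p x)) \<psi> = (\<Sum>a<4 * N. of_int (f a) * \<psi> (int g ^ a mod int p))"
proof -
  have range: "(1 - x) mod int p \<in> {0..int p - 1}" for x using p_gt_2 by simp
  have "jacobi_sum p (\<lambda>x. of_int (quad_char p x)) \<psi> =
      (\<Sum>x\<in>{0..int p - 1}. of_int (L x) * \<psi> ((1 - x) mod int p))"
    by (simp add: jacobi_sum_def carrier_Fp minus_Fp quad_char_def)
  also have "\<dots> = (\<Sum>y\<in>{0..int p - 1}. of_int (L (1 - y)) * \<psi> y)"
  proof (rule sum.reindex_bij_witness[where i = "\<lambda>x. (1 - x) mod int p" and j = "\<lambda>x. (1 - x) mod int p"])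
    fix x assume "x \<in> {0..int p - 1}"
    then show "(1 - (1 - x) mod int p) mod int p = x" by (simp add: mod_simps)
    then show "of_int (L (1 - (1 - x) mod int p)) * \<psi> ((1 - x) mod int p) =
        of_int (L x) * \<psi> ((1 - x) mod int p)"
      by (metis Legendre_mod)
  qed (use range in \<open>auto simp: mod_simps\<close>)
  also have "{0..int p - 1} = insert 0 {1..int p - 1}" using p_gt_2 by auto
  also have "(\<Sum>y\<in>insert 0 {1..int p - 1}. of_int (L (1 - y)) * \<psi> y) =
      (\<Sum>y\<in>{1..int p - 1}. of_int (L (1 - y)) * \<psi> y)"
    using assms by simp
  also have "\<dots> = (\<Sum>a<4 * N. of_int (L (1 - int g ^ a mod int p)) * \<psi> (int g ^ a mod int p))"
    by (rule sum_residues[symmetric])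
  also have "\<dots> = (\<Sum>a<4 * N. of_int (f a) * \<psi> (int g ^ a mod int p))"
  proof -
    have "L (1 - int g ^ a mod int p) = f a" for a
      unfolding f_def by (intro Legendre_cong cong_diff) (simp_all add: cong_def)
    then show ?thesis by (simp only:)
  qed
  finally show ?thesis .
qed

lemma char_power_g:
  assumes "\<chi> \<in> carrier (char_group p)"
  shows "\<chi> (int g ^ a mod int p) = \<chi> (int g mod int p) ^ a"
proof (induction a)
  case 0
  have "1 \<in> {1..int p - 1}" using p_gt_2 by simp
  then have "\<chi> (1 * 1 mod int p) = \<chi> 1 * \<chi> 1" "\<chi> 1 \<noteq> 0"
    using assms unfolding carrier_char_group by blast+
  then show ?case using p_gt_2 by simp
next
  case (Suc a)
  have "\<chi> ((int g mod int p) * (int g ^ a mod int p) mod int p) = \<chi> (int g mod int p) * \<chi> (int g ^ a mod int p)"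
    using assms power_in_residues[of a] power_in_residues[of 1]
    unfolding carrier_char_group power_one_right by blast
  then show ?case using Suc by (simp add: mod_simps)
qed

lemma char_power_cong:
  assumes "int g ^ a mod int p = int g ^ b mod int p"
  shows "[a = b] (mod 4 * N)"
proof -
  have "[int (g ^ a) = int (g ^ b)] (mod int p)" using assms by (simp add: cong_def)
  then have "[g ^ a = g ^ b] (mod p)" by (simp only: cong_int_iff)
  then show ?thesis
    using order_divides_expdiff[of p g a b] g_ord primroot by (simp add: residue_primroot_def coprime_commute)
qed

text \<open>The group contains a character \<psi> taking \<open>g\<close> to a primitive 4N-th root
  of unity \<omega>. As \<psi> is a power of the generator, \<omega> is a power of \<chi>(g), so the
  order of \<chi>(g) cannot be smaller than 4N.\<close>

lemma generator_primitive:
  assumes "char_generator p \<chi>"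
  shows "prime_root p N g (\<chi> (int g mod int p))"
proof (unfold_locales)
  let ?\<xi> = "\<chi> (int g mod int p)"
  let ?n = "4 * N"
  interpret G: group "char_group p" by (rule group_char_group)
  have \<chi>: "\<chi> \<in> carrier (char_group p)" and gen: "generate (char_group p) {\<chi>} = carrier (char_group p)"
    using assms by (auto simp: char_generator_def)
  define \<omega> where "\<omega> = cis (2 * pi / real ?n)"
  have \<omega>_power: "\<omega> ^ k = cis (2 * pi * real k / real ?n)" for k
    by (simp add: \<omega>_def DeMoivre mult_ac)
  have \<omega>_n: "\<omega> ^ ?n = 1" using N_pos by (simp only: \<omega>_power) simp
  have \<omega>_mod: "\<omega> ^ a = \<omega> ^ (a mod ?n)" for a
    using \<omega>_n by (metis mod_mult_div_eq mult.right_neutral power_add power_mult power_one)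
  \<comment> \<open>A discrete logarithm: it is determined only modulo 4N, which suffices because
    \<omega>^(4N) = 1.\<close>
  define ind where "ind x = (SOME a. int g ^ a mod int p = x)" for x
  have ind: "int g ^ ind x mod int p = x" if "x \<in> {1..int p - 1}" for x
    unfolding ind_def using residue_is_power[OF that] by (metis (mono_tags) someI)
  define \<psi> where "\<psi> x = (if x \<in> {1..int p - 1} then \<omega> ^ ind x else 0)" for x
  have \<psi>_g: "\<psi> (int g ^ a mod int p) = \<omega> ^ a" for a
  proof -
    have "[ind (int g ^ a mod int p) = a] (mod ?n)"
      by (intro char_power_cong ind power_in_residues)
    then have "\<omega> ^ ind (int g ^ a mod int p) = \<omega> ^ a"
      using \<omega>_mod by (metis cong_def)
    then show ?thesis using power_in_residues by (simp only: \<psi>_def if_True)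
  qed
  have "\<psi> \<in> carrier (char_group p)"
    unfolding carrier_char_group
  proof (intro conjI ballI allI impI)
    fix x y assume xy: "x \<in> {1..int p - 1}" "y \<in> {1..int p - 1}"
    have "x * y mod int p = int g ^ (ind x + ind y) mod int p"
      using ind[OF xy(1)] ind[OF xy(2)] by (metis mod_mult_eq power_add)
    then have "\<psi> (x * y mod int p) = \<omega> ^ (ind x + ind y)" by (simp only: \<psi>_g)
    then show "\<psi> (x * y mod int p) = \<psi> x * \<psi> y"
      using xy by (simp add: \<psi>_def power_add)
  qed (auto simp: \<psi>_def \<omega>_def)
  then obtain k :: int where k: "\<psi> = \<chi> [^]\<^bsub>char_group p\<^esub> k"
    unfolding gen[symmetric] G.generate_pow[OF \<chi>] by auto
  have "\<omega> = ?\<xi> powi k"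
    using \<psi>_g[of 1] power_in_residues[of 1] unfolding k by (simp add: char_int_power[OF \<chi>])
  moreover have "?\<xi> ^ ?n = 1"
  proof -
    have "int g ^ ?n mod int p = int g ^ 0 mod int p"
      using g_power_eq_1_iff[of ?n] by (simp add: cong_def)
    then show ?thesis using char_power_g[OF \<chi>, of ?n] char_power_g[OF \<chi>, of 0] by simp
  qed
  ultimately show "?\<xi> ^ t = 1 \<longleftrightarrow> ?n dvd t" for t
  proof safe
    assume "\<omega> = ?\<xi> powi k" "?\<xi> ^ t = 1"
    moreover have "(?\<xi> powi k) ^ t = (?\<xi> ^ t) powi k"
      by (simp only: power_int_power power_int_power' mult.commute)
    ultimately have "\<omega> ^ t = 1" by simp
    then have "\<omega> ^ (t mod ?n) = \<omega> ^ 0" using \<omega>_mod by simp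
    then have "cis (2 * pi * real (t mod ?n) / real ?n) = cis (2 * pi * real 0 / real ?n)"
      by (simp only: \<omega>_power)
    moreover have inj: "inj_on (\<lambda>k. cis (2 * pi * real k / real ?n)) {..<?n}"
      using bij_betw_roots_unity[of ?n] N_pos by (simp add: bij_betw_def)
    ultimately have "t mod ?n = 0"
      using N_pos by (intro inj_onD[OF inj]) auto
    then show "?n dvd t" by (simp add: dvd_eq_mod_eq_0)
  qed (auto simp: power_mult)
qed

lemma squares_eq: "squares p = (\<lambda>x. x * x mod int p) ` {0..int p - 1}"
  by (simp add: squares_def mult_Fp carrier_Fp)

lemma nonzero_squares: "bij_betw (\<lambda>a. int g ^ (2 * a) mod int p) {..<2 * N} (squares p - {0})"
proof (rule bij_betw_imageI)
  show "inj_on (\<lambda>a. int g ^ (2 * a) mod int p) {..<2 * N}"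
  proof (rule inj_onI)
    fix a b assume *: "a \<in> {..<2 * N}" "b \<in> {..<2 * N}"
      "int g ^ (2 * a) mod int p = int g ^ (2 * b) mod int p"
    have "2 * a = 2 * b"
      by (rule inj_onD[OF bij_betw_imp_inj_on[OF g_residues] *(3)]) (use * in auto)
    then show "a = b" by simp
  qed
  show "(\<lambda>a. int g ^ (2 * a) mod int p) ` {..<2 * N} = squares p - {0}"
  proof (intro equalityI subsetI)
    fix y assume "y \<in> (\<lambda>a. int g ^ (2 * a) mod int p) ` {..<2 * N}"
    then obtain a where a: "y = int g ^ (2 * a) mod int p" by blast
    have "y = (int g ^ a mod int p) * (int g ^ a mod int p) mod int p"
      unfolding a by (simp add: mod_simps mult_2 power_add)
    then have "y \<in> squares p"
      unfolding squares_eq using power_in_residues[of a] by (intro image_eqI) auto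
    then show "y \<in> squares p - {0}"
      using power_in_residues[of "2 * a"] a by simp
  next
    fix y assume y: "y \<in> squares p - {0}"
    then obtain x where x: "x \<in> {0..int p - 1}" "y = x * x mod int p" by (auto simp: squares_eq)
    then have "x \<in> {1..int p - 1}" using y by (cases "x = 0") auto
    then obtain a where a: "a < 4 * N" "x = int g ^ a mod int p" by (rule residue_is_power)
    show "y \<in> (\<lambda>a. int g ^ (2 * a) mod int p) ` {..<2 * N}"
    proof (rule image_eqI)
      have "[2 * (a mod (2 * N)) = 2 * a] (mod 4 * N)"
        by (simp add: cong_def mult_mod_right)
      then have "[g ^ (2 * (a mod (2 * N))) = g ^ (2 * a)] (mod p)"
        using order_divides_expdiff[of p g] g_ord primroot by (simp add: residue_primroot_def coprime_commute)
      then have "[int g ^ (2 * (a mod (2 * N))) = int g ^ (2 * a)] (mod int p)"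
        using cong_int_iff[of "g ^ (2 * (a mod (2 * N)))" "g ^ (2 * a)" p] by simp
      moreover have "y = int g ^ (2 * a) mod int p"
        unfolding x(2) a(2) by (simp add: mod_simps mult_2 power_add)
      ultimately show "y = int g ^ (2 * (a mod (2 * N))) mod int p"
        by (simp add: cong_def)
      show "a mod (2 * N) \<in> {..<2 * N}" using N_pos by simp
    qed
  qed
qed

end

context prime_root
begin

text \<open>Write d = g^r, with r odd as d is a nonsquare, and the nonzero squares as g^(2B). With
  -1 = g^(2N), dividing s_i + d s_j by the square s_i gives 1 - g^(2N + r + 2B_j - 2B_i). This is
  the bordered group matrix with odd shift 2N + r, for any enumeration \<open>s\<close>.\<close>

lemma norm_det_T_mat:
  assumes s: "bij_betw s {0..2 * N} (squares p)" "s 0 = 0"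
    and d: "d \<in> carrier (mult_of (Fp p))" "d \<notin> squares p"
  shows "\<bar>real_of_int (det (T_mat p (2 * N) s d))\<bar> = real (2 * N) * (\<Prod>k = 1..<2 * N. norm (S k))"
proof -
  let ?G = "\<lambda>a. int g ^ (2 * a) mod int p"
  obtain r where r: "d = int g ^ r mod int p"
    using d(1) unfolding carrier_mult_of_Fp by (rule residue_is_power)
  have "odd r"
  proof
    assume "even r"
    then obtain a where a: "r = 2 * a" by (elim evenE)
    have "d = (int g ^ a mod int p) * (int g ^ a mod int p) mod int p"
      unfolding r a by (simp add: mod_simps mult_2 power_add)
    then have "d \<in> squares p"
      unfolding squares_eq using power_in_residues[of a] by (intro image_eqI) auto
    with d(2) show False ..
  qed
  have "bij_betw s ({0..2 * N} - {0}) (squares p - {0})"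
  proof (rule bij_betw_imageI)
    have inj: "inj_on s {0..2 * N}" using s(1) by (rule bij_betw_imp_inj_on)
    then show "inj_on s ({0..2 * N} - {0})" by (rule inj_on_diff)
    show "s ` ({0..2 * N} - {0}) = squares p - {0}"
      using inj_on_image_set_diff[OF inj, of "{0..2 * N}" "{0}"] bij_betw_imp_surj_on[OF s(1)] s(2) by simp
  qed
  moreover have "bij_betw Suc {..<2 * N} ({0..2 * N} - {0})"
    by (rule bij_betwI[where g = "\<lambda>i. i - 1"]) auto
  ultimately have "bij_betw (s \<circ> Suc) {..<2 * N} (squares p - {0})"
    by (rule bij_betw_trans[rotated])
  from bij_betw_trans[OF this bij_betw_the_inv_into[OF nonzero_squares]]
  have B: "bij_betw (the_inv_into {..<2 * N} ?G \<circ> (s \<circ> Suc)) {..<2 * N} {..<2 * N}" .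
  define B where "B = the_inv_into {..<2 * N} ?G \<circ> (s \<circ> Suc)"
  have s_Suc: "s (Suc i) = ?G (B i)" if "i < 2 * N" for i
  proof -
    have "s (Suc i) \<in> squares p - {0}"
      using bij_betwE[OF \<open>bij_betw (s \<circ> Suc) {..<2 * N} (squares p - {0})\<close>] that by auto
    then show ?thesis
      unfolding B_def using f_the_inv_into_f_bij_betw[OF nonzero_squares, of "s (Suc i)"] by simp
  qed
  have B_less: "B i < 2 * N" if "i < 2 * N" for i
    using bij_betwE[OF B] that unfolding B_def by auto
  have "T_mat p (2 * N) s d = mat (2 * N + 1) (2 * N + 1) (\<lambda>(i, j). L (s i + d * s j))"
    unfolding T_mat_def quad_char_def add_Fp mult_Fp
    by (intro cong_mat refl) (simp add: Legendre_mod, intro Legendre_cong, simp add: cong_def mod_simps)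
  moreover have "\<bar>real_of_int (det (mat (2 * N + 1) (2 * N + 1) (\<lambda>(i, j). L (s i + d * s j))))\<bar> =
    real (2 * N) * (\<Prod>k = 1..<2 * N. norm (S k))"
  proof (rule norm_det_bordered)
    show "bij_betw B {..<2 * N} {..<2 * N}" using B by (simp only: B_def)
    show "odd (2 * N + r)" using \<open>odd r\<close> by simp
    show "L (s 0 + d * s 0) = 0" by (simp add: s Legendre_0)
    show "L (s 0 + d * s (Suc j)) = -1" if "j < 2 * N" for j
      using \<open>odd r\<close> unfolding s_Suc[OF that] s(2) r
      by (simp add: Legendre_mult Legendre_mod Legendre_power Legendre_g power_mult)
    show "L (s (Suc i) + d * s 0) = 1" if "i < 2 * N" for i
      unfolding s_Suc[OF that] s(2) by (simp add: Legendre_mod Legendre_power Legendre_g power_mult)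
    show "L (s (Suc i) + d * s (Suc j)) = f (2 * N + r + 2 * B j + (4 * N - 2 * B i))"
      if "i < 2 * N" "j < 2 * N" for i j
    proof -
      let ?a = "2 * N + r + 2 * B j + (4 * N - 2 * B i)"
      have "int g ^ (2 * B i) * int g ^ ?a = int g ^ (2 * N) * int g ^ (4 * N) * (int g ^ r * int g ^ (2 * B j))"
        using B_less[OF that(1)] by (simp add: power_add[symmetric] add_ac)
      also have "[int g ^ (2 * N) * int g ^ (4 * N) * (int g ^ r * int g ^ (2 * B j)) =
          - 1 * 1 * (d * s (Suc j))] (mod int p)"
        unfolding s_Suc[OF that(2)] r
        by (intro cong_mult g_power_half) (simp_all add: g_power_eq_1_iff)
      finally have "[int g ^ (2 * B i) - int g ^ (2 * B i) * int g ^ ?a =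
          s (Suc i) - - 1 * 1 * (d * s (Suc j))] (mod int p)"
        unfolding s_Suc[OF that(1)] by (intro cong_diff) simp_all
      then have "[s (Suc i) + d * s (Suc j) = int g ^ (2 * B i) * (1 - int g ^ ?a)] (mod int p)"
        by (simp add: right_diff_distrib cong_sym)
      from Legendre_cong[OF this] show ?thesis
        by (simp add: Legendre_mult Legendre_power Legendre_g f_def power_mult)
    qed
  qed
  ultimately show ?thesis by simp
qed

lemma norm_det_T_mat_eq:
  assumes "bij_betw s {0..2 * N} (squares p)" "s 0 = 0"
    and "d \<in> carrier (mult_of (Fp p))" "d \<notin> squares p" and "p = c\<^sup>2 + 4 * b\<^sup>2"
  shows "real_of_int \<bar>det (T_mat p (2 * N) s d)\<bar> = 2 ^ (2 * N) * real b * (real N * of_int D)\<^sup>2"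
proof -
  have "norm (S N) = 2 * real b" using norm_S_N E_eq[OF assms(5)] by simp
  moreover have "(2 :: real) ^ (2 * N) = 4 * 4 ^ (N - 1)"
    using N_pos by (cases N) (simp_all add: power_mult)
  ultimately show ?thesis
    using norm_det_T_mat[OF assms(1-4)] unfolding prod_norm_S
    by (simp add: power2_eq_square mult_ac)
qed

text \<open>Each difference of Jacobi sums is 2 S k, and the powers of 2 from \<open>prod_S\<close>
  and from sqrt(p - 1) = 2 sqrt N cancel the denominator. What remains is sqrt N * u * D, where u^2
  = N because the power of the imaginary unit compensates the sign in
  \<open>prod_sn_squared\<close>. Only the sign of u stays open, recorded by
  \<open>e\<close>.\<close>

lemma z_val_eq:
  assumes \<chi>: "\<chi> \<in> carrier (char_group p)" and \<xi>: "\<chi> (int g mod int p) = \<xi>"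
  obtains e :: int where "e\<^sup>2 = 1" "z_val p (2 * N) \<chi> = of_int (e * int N * D)"
proof -
  let ?J = "\<lambda>k. jacobi_sum p (\<lambda>x. of_int (quad_char p x)) (\<chi> [^]\<^bsub>char_group p\<^esub> (k :: int))"
  let ?\<Pi> = "\<Prod>k = 1..<N. R.sn k"
  have J: "?J k = (\<Sum>a<4 * N. of_int (f a) * (\<xi> ^ a) powi k)" for k
  proof -
    have "?J k = (\<Sum>a<4 * N. of_int (f a) * (\<chi> [^]\<^bsub>char_group p\<^esub> k) (int g ^ a mod int p))"
      by (rule jacobi_sum_eq) (simp add: char_int_power[OF \<chi>])
    then show ?thesis
      using power_in_residues by (simp only: char_int_power[OF \<chi>] if_True char_power_g[OF \<chi>] \<xi>)
  qed
  have diff: "?J (int k) - ?J (- int k) = 2 * S k" for k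
    unfolding J sum_full_period[of k, symmetric] sum_subtractf[symmetric] right_diff_distrib[symmetric]
    by (simp add: power_int_minus power_mult power_divide divide_inverse power_inverse)
  have diff': "?J k - ?J (- k) = 2 * S (nat k)" if "0 < k" for k
    using diff[of "nat k"] that by simp
  have "(\<Prod>k\<in>{k::int. 0 < k \<and> 2 * k < int (2 * N)}. ?J k - ?J (- k)) = (\<Prod>k = 1..<N. 2 * S k)"
    by (rule prod.reindex_bij_witness[where i = int and j = nat]) (auto simp: diff')
  also have "\<dots> = 2 ^ (N - 1) * (2 ^ (N - 1) * ?\<Pi> * of_int D)"
    unfolding prod.distrib prod_S by simp
  finally have prod: "(\<Prod>k\<in>{k::int. 0 < k \<and> 2 * k < int (2 * N)}. ?J k - ?J (- k)) =
    2 ^ (N - 1) * (2 ^ (N - 1) * ?\<Pi> * of_int D)" .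
  have root: "sqrt (real p - 1) = 2 * sqrt (real N)"
    by (simp add: p_eq real_sqrt_mult)
  have exps: "(2 * N - 2) div 2 = N - 1" "2 * N - 1 = Suc ((N - 1) + (N - 1))"
    using N_pos by auto
  define u where "u = \<i> ^ (N - 1) * ?\<Pi>"
  have z: "z_val p (2 * N) \<chi> = complex_of_real (sqrt (real N)) * u * of_int D"
    unfolding z_val_def y_val_def prod root exps u_def by (simp add: power_add)
  have "u\<^sup>2 = (\<i>\<^sup>2) ^ (N - 1) * (?\<Pi>\<^sup>2)"
    unfolding u_def power_mult_distrib by (simp only: power_mult[symmetric] mult.commute)
  also have "\<dots> = (- 1 * - 1) ^ (N - 1) * of_nat N"
    unfolding prod_sn_squared by (simp only: power2_i mult.assoc[symmetric] power_mult_distrib)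
  also have "\<dots> = (complex_of_real (sqrt (real N)))\<^sup>2"
    by (simp flip: of_real_power)
  finally have "u = complex_of_real (sqrt (real N)) \<or> u = - complex_of_real (sqrt (real N))"
    by (simp only: power2_eq_iff)
  moreover have "complex_of_real (sqrt (real N)) * complex_of_real (sqrt (real N)) = of_nat N"
    by (simp flip: of_real_mult)
  ultimately have "z_val p (2 * N) \<chi> = of_int (1 * int N * D) \<or> z_val p (2 * N) \<chi> = of_int ((- 1) * int N * D)"
    unfolding z by auto
  then show ?thesis
  proof
    assume "z_val p (2 * N) \<chi> = of_int (1 * int N * D)"
    then show ?thesis by (rule that[rotated]) simp
  next
    assume "z_val p (2 * N) \<chi> = of_int ((- 1) * int N * D)"
    then show ?thesis by (rule that[rotated]) simp
  qed
qed

text \<open>Modulo \<open>p\<close>, 4N = -1, and both 4 and -1 are squares.\<close>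

lemma Legendre_N: "L (int N) = 1"
proof -
  have "[4 * int N = -1] (mod int p)" by (simp add: cong_iff_dvd_diff p_eq add.commute)
  then have "L (2 * (2 * int N)) = 1"
    using Legendre_cong Legendre_neg1 by fastforce
  then show ?thesis using Legendre_2_square by (simp only: Legendre_mult mult.assoc[symmetric] mult_1_left)
qed

end

theorem corollary1:
  fixes p n b c :: nat and \<chi> :: "int \<Rightarrow> complex" and s :: "nat \<Rightarrow> int"
  assumes "prime p" and "p = 2 * n + 1" and "[p = 1] (mod 4)"
    and "b > 0" and "c > 0" and "p = c\<^sup>2 + 4 * b\<^sup>2"
    and "char_generator p \<chi>"
    and "bij_betw s {0..n} (squares p)" and "s 0 = 0" and "s 1 = 1"
  shows "\<exists>z::int. z_val p n \<chi> = of_int z \<and> Legendre z (int p) = 1 \<and>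
           (\<forall>d\<in>carrier (mult_of (Fp p)). d \<notin> squares p \<longrightarrow>
              real_of_int \<bar>det (T_mat p n s d)\<bar> / (2 ^ ((p - 1) div 2) * real b) = (of_int z)\<^sup>2)"
proof -
  have "even n" using assms(2,3) by (auto simp: cong_def) presburger
  then obtain N where n: "n = 2 * N" by (elim evenE)
  obtain g where "residue_primroot p g"
    using prime_primitive_root_exists[of p] assms(1) prime_gt_1_nat by auto
  then interpret prime_primroot p N g
    using assms(1,2) n by unfold_locales auto
  interpret prime_root p N g "\<chi> (int g mod int p)"
    by (rule generator_primitive[OF assms(7)])
  have "\<chi> \<in> carrier (char_group p)" using assms(7) by (simp add: char_generator_def)
  then obtain e :: int where e: "e\<^sup>2 = 1" "z_val p (2 * N) \<chi> = of_int (e * int N * D)"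
    using z_val_eq by blast
  \<comment> \<open>The undetermined sign is harmless: -1 is a square modulo \<open>p\<close>, and
    the determinant formula involves only z^2.\<close>
  have "e = 1 \<or> e = -1" using e(1) by (simp add: power2_eq_1_iff)
  then have "L (e * int N * D) = 1"
    using Legendre_1 Legendre_neg1 by (auto simp: Legendre_mult Legendre_minus Legendre_N Legendre_D)
  moreover have "real_of_int \<bar>det (T_mat p n s d)\<bar> / (2 ^ ((p - 1) div 2) * real b) = (of_int (e * int N * D))\<^sup>2"
    if "d \<in> carrier (mult_of (Fp p))" "d \<notin> squares p" for d
  proof -
    have "real_of_int \<bar>det (T_mat p (2 * N) s d)\<bar> = 2 ^ (2 * N) * real b * (real N * of_int D)\<^sup>2"
      by (rule norm_det_T_mat_eq[OF assms(8)[unfolded n] assms(9) that assms(6)])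
    moreover have "(p - 1) div 2 = 2 * N" by (simp add: p_eq)
    moreover have "(real_of_int (e * int N * D))\<^sup>2 = (real N * of_int D)\<^sup>2"
      using \<open>e = 1 \<or> e = -1\<close> by auto
    ultimately show ?thesis using assms(4) unfolding n by simp
  qed
  ultimately show ?thesis using e(2) unfolding n by blast
qed

end
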